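(* Let $n\ge1$. Assume $|q|\neq1$, $b_6\neq0$, $b_5^2\neq q^{-1},1,q$ and $a_n\neq0$, and that the denominators occurring below are nonzero. Then the entries of the spectral matrix $A_n^*$ are given by $$\mathfrak T_{n,+}=\frac{b_6}{b_5}(q^{-1}-b_5^2)a_n\,x(x-g_n),\qquad \mathfrak T_{n,-}=\frac{b_6}{b_5}(1-q^{-1}b_5^2)a_n\,x(x-g_{n-1}),$$ and $$\frac{\mathfrak W_{n,+}}{x(x-g_n)}=-xb_5b_6+\frac{b_6}{1-b_5^2}\left[-\frac{b_5^2}{t}+b_5\left(\frac1{b_1}+\frac1{b_2}+\frac1{b_3}+\frac1{b_4}\right)\right]-\frac{b_6(b_5f_n-t)}{(1-b_5^2)t}\left[\frac{g_n(t-f_nb_5)}{f_n}+\frac{tb_5(1+b_6^2)}{b_6}\right]$$ $$+\frac{b_6t}{1-b_5^2}\left[\frac{b_5^2}{g_n^2}-\frac{1-b_5^2}{xg_n}-(b_1+b_2+b_3+b_4)\frac{b_5^2}{g_n}+b_5^2\frac{f_n}{g_n}-\frac{g_n}{f_n}+\frac{(g_n-xb_5^2)\prod_{j=1}^4(1-g_nb_j)}{(1-f_ng_n)g_n^2(x-g_n)}\right],$$ or equivalently $$\frac{\mathfrak W_{n,+}}{x(x-g_n)}=-\frac{b_6t}{1-b_5^2}\,\frac{(1-b_5^2f_nx)\prod_{j=1}^4(f_n-b_j)}{f_n^2(1-f_ng_n)(1-f_nx)}+\frac{b_6t\prod_{j=1}^4(1-xb_j)}{x(1-xf_n)(x-g_n)}-\frac{b_6(b_5f_n-t)}{f_n}x$$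 $$-\frac{b_6(b_5f_n-t)}{b_5(1-b_5^2)t}\left\{\frac{b_5^2(1+b_6^2)t}{b_6}+\frac{b_5g_n}{f_n}(t-b_5f_n)+\frac{b_5}{f_n^2}\left[t+b_5f_n-tf_n\left(\frac1{b_1}+\frac1{b_2}+\frac1{b_3}+\frac1{b_4}\right)\right]\right\};$$ and $$\frac{t\,\mathfrak W_{n,-}}{x(x-g_n)}=\frac{(1-xf_n)(x-b_6t)(xb_6-t)}{x(x-g_n)}-\frac{b_6}{1-b_5^2}\,\frac{\prod_{j=1}^4(t-b_jb_5)}{b_5(tg_n-b_5)}$$ $$+\frac{b_6(b_5f_n-t)}{b_5(1-b_5^2)}\left[(1-b_5^2)x-\frac{t^2}{g_n}-g_nb_5^2+\frac{b_5^2(1+b_6^2)t}{b_6}-\frac{b_5t^2\prod_{j=1}^4(1-g_nb_j)}{g_n(1-f_ng_n)(tg_n-b_5)}\right],$$ or equivalently $$\frac{t\,\mathfrak W_{n,-}}{x(x-g_n)}=\frac{(1-xf_n)(x-b_6t)(b_6x-t)}{x(x-g_n)}+\frac{b_6t^2}{1-b_5^2}\,\frac{\prod_{j=1}^4(f_n-b_j)}{f_n^2(1-f_ng_n)}$$ $$+\frac{b_6(b_5f_n-t)}{b_5(1-b_5^2)}\left\{(1-b_5^2)x+\frac{b_5^2(1+b_6^2)t}{b_6}+\frac{b_5g_n}{f_n}(t-b_5f_n)+\frac{b_5}{f_n^2}\left[t+b_5f_n-tf_n\left(\frac1{b_1}+\frac1{b_2}+\frac1{b_3}+\frac1{b_4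}\right)\right]\right\}.$$
   Context: Fix $q$ with $0<|q|<1$, $(a;q)_\infty=\prod_{j\ge0}(1-aq^j)$, $(a_1,\dots,a_m;q)_\infty=\prod_i(a_i;q)_\infty$. Let $b_1,b_2,b_3,b_4,b_6$ be nonzero complex parameters with $b_1b_2b_3b_4=1$, and let $t\ne0$ be the deformation variable. Non-vanishing hypotheses are understood at every point of the lattice $tq^{\mathbb Z}$ that is involved. The weight is $$w(x;t)=\frac{(b_2x,b_3x,b_6^{-1}xt^{-1};q)_\infty}{(b_1x,b_4x,b_6xt^{-1};q)_\infty}.$$ Put $$D_+(x;t)=b_6(1-b_1x)(1-b_4x)(t-b_6x),\qquad D_-(x;t)=(1-b_2x)(1-b_3x)(b_6t-x),$$ $$E_+(x;t)=b_6^{-1}(b_6qt-x),\qquad E_-(x;t)=qt-b_6x,$$ so that $w(qx;t)/w(x;t)=D_+/D_-$ and $w(x;qt)/w(x;t)=E_+/E_-$. Orthogonality is with respect to a Thomae–Jackson $q$-integral $\int_G$ in $x$ whose terminals coincide with zeros/poles of the weight, so that boundary terms vanish. Concretely, the Stieltjes function $\phi(x;t)=\int_G \frac{w(y;t)}{x-y}$ satisfies $D_-(x;t)\phi(qx;t)=D_+(x;t)\phi(x;t)+(q-1)x\,U(x;t)$ and $E_-(x;t)\phi(x;qt)=E_+(x;t)\phi(x;t)+(q-1)t\,T(x;t)$ with $U,T$ polynomial in $x$. The orthonormal polynomials $p_n(x;t)=\gamma_nx^n+\cdots$ ($\int_G w\,p_np_m=\delta_{nm}$, $\gamma_n=\gamma_n(t)\ne0$)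 are assumed to exist for all $n\ge0$; $a_n=\gamma_{n-1}/\gamma_n$ for $n\ge1$ is the off-diagonal coefficient of the three-term recurrence, and $a_0$ is an arbitrary nonzero quantity. Functions of the second kind: $q_n(x;t)=\int_G \frac{w(y;t)p_n(y;t)}{x-y}$ for $n\ge0$, with $p_{-1}=0$, $q_{-1}=1/(a_0\gamma_0)$. Set $$Y_n(x;t)=\begin{pmatrix}p_n & q_n/w\\ p_{n-1}& q_{n-1}/w\end{pmatrix}.$$ The spectral matrix $A_n^*$ is the matrix, polynomial in $x$, defined by $D_+(x;t)\,Y_n(qx;t)=A_n^*(x;t)\,Y_n(x;t)$, with entries written $$A_n^*=\begin{pmatrix}\mathfrak W_{n,+}&-\mathfrak T_{n,+}\\ \mathfrak T_{n,-}&\mathfrak W_{n,-}\end{pmatrix}.$$ Put $b_5=b_1b_4b_6q^n$ (so $b_5$ depends on $n$; in the formulas it is the value for the index $n$). For each index $m\ge 0$, $\mathfrak T_{m,+}$ is $x$ times a polynomial of degree one in $x$, and $g_m=g_m(t)$ denotes the zero of that degree-one polynomial. The variable $f_n=f_n(t)$ is defined by $$\mathfrak W_{n,+}(g_n(t);t)=-\frac1t\,(g_n(t)-b_6t)(b_6g_n(t)-t)\,\big(f_n(q^{-1}t)\,g_n(t)-1\big),$$ where it is assumed that $g_n(t)\ne 0,\,b_6t,\,b_6^{-1}t$ so that $f_n$ is well defined. *)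

theory Defs
  imports "HOL-Analysis.Analysis" "HOL-Computational_Algebra.Polynomial"
begin

definition qpoch_inf :: "complex \<Rightarrow> complex \<Rightarrow> complex" where
  "qpoch_inf a q = (\<Prod>j. 1 - a * q ^ j)"

text \<open>
  The parameters b_1, b_2, b_3, b_4, b_6 are the values of one family \<open>b\<close>
  at 1, 2, 3, 4, 6; no other value of \<open>b\<close> is ever used.
\<close>

definition weight_num :: "complex \<Rightarrow> (nat \<Rightarrow> complex) \<Rightarrow> complex \<Rightarrow> complex \<Rightarrow> complex" where
  "weight_num q b t x =
     qpoch_inf (b 2 * x) q * qpoch_inf (b 3 * x) q * qpoch_inf (x / (b 6 * t)) q"

definition weight_den :: "complex \<Rightarrow> (nat \<Rightarrow> complex) \<Rightarrow> complex \<Rightarrow> complex \<Rightarrow> complex" where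
  "weight_den q b t x =
     qpoch_inf (b 1 * x) q * qpoch_inf (b 4 * x) q * qpoch_inf (b 6 * x / t) q"

definition weight :: "complex \<Rightarrow> (nat \<Rightarrow> complex) \<Rightarrow> complex \<Rightarrow> complex \<Rightarrow> complex" where
  "weight q b t x = weight_num q b t x / weight_den q b t x"

definition D_plus :: "(nat \<Rightarrow> complex) \<Rightarrow> complex \<Rightarrow> complex \<Rightarrow> complex" where
  "D_plus b t x = b 6 * (1 - b 1 * x) * (1 - b 4 * x) * (t - b 6 * x)"

definition D_minus :: "(nat \<Rightarrow> complex) \<Rightarrow> complex \<Rightarrow> complex \<Rightarrow> complex" where
  "D_minus b t x = (1 - b 2 * x) * (1 - b 3 * x) * (b 6 * t - x)"

definition E_plus :: "complex \<Rightarrow> (nat \<Rightarrow> complex) \<Rightarrow> complex \<Rightarrow> complex \<Rightarrow> complex" where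
  "E_plus q b t x = inverse (b 6) * (b 6 * q * t - x)"

definition E_minus :: "complex \<Rightarrow> (nat \<Rightarrow> complex) \<Rightarrow> complex \<Rightarrow> complex \<Rightarrow> complex" where
  "E_minus q b t x = q * t - b 6 * x"

text \<open>
  The Thomae--Jackson integral between the terminals \<open>fst G\<close> and \<open>snd G\<close>, that is, the
  integral from 0 to \<open>snd G\<close> minus the integral from 0 to \<open>fst G\<close>.
\<close>

definition q_integral :: "complex \<Rightarrow> complex \<times> complex \<Rightarrow> (complex \<Rightarrow> complex) \<Rightarrow> complex" where
  "q_integral q G f =
     (1 - q) * snd G * (\<Sum>k. q ^ k * f (snd G * q ^ k))
   - (1 - q) * fst G * (\<Sum>k. q ^ k * f (fst G * q ^ k))"

text \<open>The lattice points carrying the integral, together with their accumulation point 0.\<close>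

definition q_support :: "complex \<Rightarrow> complex \<times> complex \<Rightarrow> complex set" where
  "q_support q G = insert 0 (range (\<lambda>k. fst G * q ^ k) \<union> range (\<lambda>k. snd G * q ^ k))"

definition stieltjes ::
  "complex \<Rightarrow> (nat \<Rightarrow> complex) \<Rightarrow> complex \<times> complex \<Rightarrow> complex \<Rightarrow> complex \<Rightarrow> complex" where
  "stieltjes q b G t x = q_integral q G (\<lambda>y. weight q b t y / (x - y))"

definition orthonormal_polys ::
  "complex \<Rightarrow> (nat \<Rightarrow> complex) \<Rightarrow> complex \<times> complex \<Rightarrow> complex \<Rightarrow> (nat \<Rightarrow> complex poly) \<Rightarrow> bool" where
  "orthonormal_polys q b G t p \<longleftrightarrow>
     (\<forall>n. degree (p n) = n) \<and>
     (\<forall>m n. q_integral q G (\<lambda>y. weight q b t y * poly (p n) y * poly (p m) y)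
              = (if n = m then 1 else 0))"

definition rec_coeff :: "complex \<Rightarrow> (nat \<Rightarrow> complex poly) \<Rightarrow> nat \<Rightarrow> complex" where
  "rec_coeff a0 p n = (if n = 0 then a0 else lead_coeff (p (n - 1)) / lead_coeff (p n))"

definition second_kind ::
  "complex \<Rightarrow> (nat \<Rightarrow> complex) \<Rightarrow> complex \<times> complex \<Rightarrow> complex \<Rightarrow> (nat \<Rightarrow> complex poly)
    \<Rightarrow> nat \<Rightarrow> complex \<Rightarrow> complex" where
  "second_kind q b G t p n x = q_integral q G (\<lambda>y. weight q b t y * poly (p n) y / (x - y))"

text \<open>The case \<open>n = 0\<close> in the second row is the convention for the index -1.\<close>

definition Y_matrix ::
  "complex \<Rightarrow> (nat \<Rightarrow> complex) \<Rightarrow> complex \<times> complex \<Rightarrow> complex \<Rightarrow> complex \<Rightarrow> (nat \<Rightarrow> complex poly)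
    \<Rightarrow> nat \<Rightarrow> complex \<Rightarrow> complex^2^2" where
  "Y_matrix q b G t a0 p n x = vector
     [vector [poly (p n) x, second_kind q b G t p n x / weight q b t x],
      vector [if n = 0 then 0 else poly (p (n - 1)) x,
              (if n = 0 then 1 / (a0 * lead_coeff (p 0)) else second_kind q b G t p (n - 1) x)
                / weight q b t x]]"

text \<open>
  The relation defining the spectral matrix is required at every \<open>x\<close> where both sides make
  sense: \<open>x\<close> and \<open>q * x\<close> lie off the support of the integral, and the weight is finite and
  nonzero at \<open>x\<close>, hence also at \<open>q * x\<close>. These \<open>x\<close> determine the polynomial matrix \<open>A\<close>.
\<close>

definition is_spectral_matrix ::
  "complex \<Rightarrow> (nat \<Rightarrow> complex) \<Rightarrow> complex \<times> complex \<Rightarrow> complex \<Rightarrow> complex \<Rightarrow> (nat \<Rightarrow> complex poly)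
    \<Rightarrow> nat \<Rightarrow> (complex poly)^2^2 \<Rightarrow> bool" where
  "is_spectral_matrix q b G t a0 p n A \<longleftrightarrow>
     (\<forall>x. x \<notin> q_support q G \<and> q * x \<notin> q_support q G \<and>
          weight_num q b t x \<noteq> 0 \<and> weight_den q b t x \<noteq> 0 \<longrightarrow>
        map_matrix (\<lambda>y. D_plus b t x * y) (Y_matrix q b G t a0 p n (q * x))
          = map_matrix (\<lambda>P. poly P x) A ** Y_matrix q b G t a0 p n x)"

end

theory Submission
  imports Defs
begin

text \<open>
  Eliminating \<open>Y\<^sub>n\<close> with the Casorati determinant \<open>p\<^sub>n q\<^sub>n\<^sub>-\<^sub>1 - q\<^sub>n p\<^sub>n\<^sub>-\<^sub>1 = 1 / a\<^sub>n\<close> expresses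
  the entries of the spectral matrix through \<open>p\<^sub>n\<close> and \<open>q\<^sub>n\<close>. Their behaviour at 0 and at infinity
  fixes the two off-diagonal entries up to one root each, and the diagonal entries up to
  the coefficients of \<open>x\<close> and \<open>x\<^sup>2\<close>. Two linear relations between these four coefficients come
  from the determinant \<open>D\<^sub>+ D\<^sub>-\<close> (the powers 1 and 5 of \<open>x\<close>). The other two are the values of the
  diagonal entries at \<open>g\<^sub>n\<close>: their product is known from the determinant, and the value of
  the lower one is obtained by comparing, in the first row of \<open>Y\<^sub>n(q x; q t)\<close>, the steps in \<open>x\<close> and in \<open>t\<close>.
  That comparison yields a polynomial of degree one whose root is the reciprocal of \<open>f\<^sub>n(t)\<close>.
\<close>

section \<open>Polynomials and limits off a countable set\<close>

lemma at_infinity_minus_countable_neq_bot: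
  fixes N :: "complex set"
  assumes "countable N"
  shows "inf at_infinity (principal (- N)) \<noteq> bot"
proof
  assume "inf at_infinity (principal (- N)) = bot"
  hence "eventually (\<lambda>x. False) (inf at_infinity (principal (- N)))" by simp
  hence "eventually (\<lambda>x. x \<in> N) at_infinity"
    by (simp add: eventually_inf_principal)
  then obtain r where r: "\<And>x. norm x \<ge> r \<Longrightarrow> x \<in> N"
    by (auto simp: eventually_at_infinity)
  obtain x where x: "x \<in> ball (of_real (\<bar>r\<bar> + 1)) 1" "x \<notin> N"
    using ball_minus_countable_nonempty[OF assms zero_less_one, of "of_real (\<bar>r\<bar> + 1)"] by blast
  have "norm (of_real (\<bar>r\<bar> + 1) :: complex) - norm x \<le> 1"
    using x(1) norm_triangle_ineq2[of "of_real (\<bar>r\<bar> + 1)" x] by (simp add: dist_norm)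
  hence "norm x \<ge> r" by (simp add: norm_of_real del: of_real_add)
  with r x show False by blast
qed

lemma at_within_minus_countable_neq_bot:
  fixes x0 :: complex
  assumes "countable N"
  shows "at x0 within (- N) \<noteq> bot"
proof -
  have "\<exists>y\<in>- N. y \<noteq> x0 \<and> dist y x0 < e" if "e > 0" for e
    using ball_minus_countable_nonempty[of "insert x0 N" e x0] assms that
    by (auto simp: dist_commute)
  thus ?thesis
    by (simp add: trivial_limit_within islimpt_approachable)
qed

lemma poly_eq_off_countable:
  fixes P Q :: "complex poly"
  assumes "countable N" "\<And>x. x \<notin> N \<Longrightarrow> poly P x = poly Q x"
  shows "P = Q"
proof (rule ccontr)
  assume "P \<noteq> Q"
  hence "finite {x. poly (P - Q) x = 0}" by (intro poly_roots_finite) auto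
  moreover have "- N \<subseteq> {x. poly (P - Q) x = 0}" using assms by auto
  ultimately have "countable (- N)" using countable_finite finite_subset by blast
  hence "countable (UNIV :: complex set)"
    using assms(1) countable_Un[of N "- N"] by simp
  thus False using uncountable_UNIV_complex by blast
qed

lemma poly_coeff_tendsto:
  fixes P :: "complex poly"
  assumes "degree P \<le> k"
  shows "((\<lambda>x. poly P x / x ^ k) \<longlongrightarrow> coeff P k) at_infinity"
proof (cases "degree P = k")
  case True
  thus ?thesis using poly_divide_tendsto_aux[of P] by simp
next
  case False
  hence "degree P < degree (monom (1::complex) k)"
    using assms by (simp add: degree_monom_eq)
  from poly_divide_tendsto_0_at_infinity[OF this] False assms show ?thesis
    by (simp add: poly_monom coeff_eq_0)
qed

lemma inverse_power_tendsto_0: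
  "k > 0 \<Longrightarrow> ((\<lambda>x::complex. 1 / x ^ k) \<longlongrightarrow> 0) at_infinity"
  using poly_coeff_tendsto[of 1 k] by (simp add: one_pCons coeff_pCons split: nat.splits)

lemma poly_coeff_limit:
  fixes P :: "complex poly"
  assumes F: "F \<le> at_infinity" "F \<noteq> bot"
    and lim: "((\<lambda>x. poly P x / x ^ k) \<longlongrightarrow> c) F"
  shows "degree P \<le> k" "coeff P k = c"
proof -
  show *: "degree P \<le> k"
  proof (rule ccontr)
    assume "\<not> degree P \<le> k"
    hence k: "k < degree P" by simp
    have nz: "eventually (\<lambda>x. x \<noteq> (0::complex)) F"
      using F(1) eventually_not_equal_at_infinity filter_leD by blast
    have "((\<lambda>x. poly P x / x ^ k * (1 / x ^ (degree P - k))) \<longlongrightarrow> c * 0) F"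
      using k by (intro tendsto_mult lim tendsto_mono[OF F(1) inverse_power_tendsto_0]) auto
    moreover have "eventually (\<lambda>x. poly P x / x ^ k * (1 / x ^ (degree P - k)) = poly P x / x ^ degree P) F"
      using nz
    proof eventually_elim
      case (elim x)
      have "x ^ degree P = x ^ k * x ^ (degree P - k)"
        using k by (simp flip: power_add)
      thus ?case by simp
    qed
    ultimately have "((\<lambda>x. poly P x / x ^ degree P) \<longlongrightarrow> c * 0) F"
      by (rule Lim_transform_eventually)
    moreover have "((\<lambda>x. poly P x / x ^ degree P) \<longlongrightarrow> lead_coeff P) F"
      by (rule tendsto_mono[OF F(1) poly_divide_tendsto_aux])
    ultimately have "lead_coeff P = 0"
      using tendsto_unique[OF F(2)] by fastforce
    thus False using k by auto
  qed
  show "coeff P k = c"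
    using tendsto_unique[OF F(2) tendsto_mono[OF F(1) poly_coeff_tendsto[OF *]] lim] .
qed

lemma poly_const_of_limit:
  fixes P :: "complex poly"
  assumes "F \<le> at_infinity" "F \<noteq> bot" "(poly P \<longlongrightarrow> c) F"
  shows "P = [:c:]"
proof -
  have "degree P \<le> 0" "coeff P 0 = c"
    using poly_coeff_limit[OF assms(1,2), of P 0 c] assms(3) by simp_all
  then obtain d where "P = [:d:]" "coeff P 0 = c" using degree_eq_zeroE by blast
  thus ?thesis by simp
qed

lemma poly_dvd_of_bounded:
  fixes P :: "complex poly"
  assumes N: "countable N" and a: "a \<noteq> 0"
    and eq: "\<And>x. x \<notin> N \<Longrightarrow> poly P x = (a * x + c) * h x"
    and bdd: "Bfun h (at (- c / a))"
  shows "\<exists>R. P = [:c, a:] * R"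
proof -
  define x0 where "x0 = - c / a"
  let ?F = "at x0 within (- N)"
  have F: "?F \<noteq> bot" by (rule at_within_minus_countable_neq_bot[OF N])
  have "((\<lambda>x. (a * x + c) * h x) \<longlongrightarrow> 0) ?F"
  proof -
    have 1: "((\<lambda>x. a * x + c) \<longlongrightarrow> a * x0 + c) ?F" by (intro tendsto_intros)
    have 2: "a * x0 + c = 0" using a by (simp add: x0_def field_simps)
    have "Bfun h ?F"
      using bdd unfolding x0_def Bfun_metric_def
      by (meson at_le eventually_mono filter_leD subset_UNIV)
    thus ?thesis
      using 1 2 bounded_bilinear.tendsto_zero bounded_bilinear.Zfun_prod_Bfun[OF bounded_bilinear_mult]
      by (simp add: tendsto_Zfun_iff)
  qed
  moreover have "eventually (\<lambda>x. (a * x + c) * h x = poly P x) ?F"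
    using eq by (auto simp: eventually_at_filter)
  ultimately have "(poly P \<longlongrightarrow> 0) ?F"
    by (rule Lim_transform_eventually)
  moreover have "(poly P \<longlongrightarrow> poly P x0) ?F"
    by (intro tendsto_intros)
  ultimately have "poly P x0 = 0" using tendsto_unique[OF F] by blast
  then obtain R where "P = [:- x0, 1:] * R" unfolding poly_eq_0_iff_dvd by (elim dvdE)
  moreover have "[:- x0, 1:] = [:c, a:] * [:1 / a:]" using a by (simp add: x0_def)
  ultimately have "P = [:c, a:] * ([:1 / a:] * R)" by (simp only: mult.assoc)
  thus ?thesis by blast
qed

lemma compact_of_isolated_points:
  fixes S :: "complex set"
  assumes "bounded S" "0 \<in> S"
    and iso: "\<And>x. x \<noteq> 0 \<Longrightarrow> \<exists>d>0. \<forall>y\<in>S. y \<noteq> x \<longrightarrow> d \<le> dist x y"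
  shows "compact S"
proof -
  have "closed S"
    unfolding closed_limpt islimpt_approachable
  proof (intro allI impI)
    fix x assume x: "\<forall>e>0. \<exists>y\<in>S. y \<noteq> x \<and> dist y x < e"
    show "x \<in> S"
    proof (cases "x = 0")
      case False
      then obtain d where "d > 0" "\<forall>y\<in>S. y \<noteq> x \<longrightarrow> d \<le> dist x y" using iso by blast
      with x show ?thesis by (metis dist_commute not_less)
    qed (use assms in auto)
  qed
  thus ?thesis using assms(1) by (simp add: compact_eq_bounded_closed)
qed

section \<open>Orthonormal polynomials and functions of the second kind\<close>

locale bounded_functional =
  fixes S :: "complex set" and I :: "(complex \<Rightarrow> complex) \<Rightarrow> complex"
  assumes compact: "compact S"
    and add: "continuous_on S f \<Longrightarrow> continuous_on S g \<Longrightarrow> I (\<lambda>y. f y + g y) = I f + I g"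
    and scale: "continuous_on S f \<Longrightarrow> I (\<lambda>y. c * f y) = c * I f"
    and bound: "\<exists>C. \<forall>f K. continuous_on S f \<longrightarrow> (\<forall>y\<in>S. norm (f y) \<le> K) \<longrightarrow> norm (I f) \<le> C * K"
    and cong: "(\<And>y. y \<in> S \<Longrightarrow> f y = h y) \<Longrightarrow> I f = I h"
begin

definition cauchy :: "complex poly \<Rightarrow> complex \<Rightarrow> complex" where
  "cauchy f x = I (\<lambda>y. poly f y / (x - y))"

lemma cont_kernel: "x \<notin> S \<Longrightarrow> continuous_on S (\<lambda>y. poly f y / (x - y))"
  by (intro continuous_intros) auto

lemma cont_poly: "continuous_on S (poly f)"
  by (intro continuous_intros)

lemma I_add: "I (poly (f + g)) = I (poly f) + I (poly g)"
  using add[OF cont_poly cont_poly, of f g] by (simp add: poly_add[abs_def])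

lemma I_smult: "I (poly (smult c f)) = c * I (poly f)"
  using scale[OF cont_poly, of c f] by (simp add: poly_smult[abs_def])

lemma I_0: "I (poly 0) = 0"
  using I_smult[of 0 0] by simp

lemma cauchy_add: "x \<notin> S \<Longrightarrow> cauchy (f + g) x = cauchy f x + cauchy g x"
  unfolding cauchy_def using add[OF cont_kernel cont_kernel, of x x f g]
  by (simp add: add_divide_distrib)

lemma cauchy_smult: "x \<notin> S \<Longrightarrow> cauchy (smult c f) x = c * cauchy f x"
  unfolding cauchy_def using scale[OF cont_kernel, of x c f] by simp

lemma cauchy_shift:
  assumes "x \<notin> S"
  shows "cauchy (pCons 0 f) x = x * cauchy f x - I (poly f)"
proof -
  have "cauchy (pCons 0 f) x = I (\<lambda>y. x * (poly f y / (x - y)) + (- 1) * poly f y)"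
    unfolding cauchy_def
  proof (rule cong)
    fix y assume "y \<in> S"
    hence "x - y \<noteq> 0" using assms by auto
    thus "poly (pCons 0 f) y / (x - y) = x * (poly f y / (x - y)) + - 1 * poly f y"
      by (simp add: field_simps)
  qed
  also have "\<dots> = I (\<lambda>y. x * (poly f y / (x - y))) + I (\<lambda>y. (- 1) * poly f y)"
    by (intro add continuous_on_mult_left cont_kernel cont_poly assms)
  also have "\<dots> = x * cauchy f x + (- 1) * I (poly f)"
    unfolding cauchy_def by (simp only: scale[OF cont_kernel[OF assms]] scale[OF cont_poly])
  finally show ?thesis by simp
qed

lemma cauchy_decomp:
  "\<exists>P. \<forall>x. x \<notin> S \<longrightarrow> cauchy f x = poly f x * cauchy 1 x - poly P x"
proof (induction f)
  case 0
  have "cauchy 0 x = 0" if "x \<notin> S" for x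
    using cauchy_smult[OF that, of 0 0] by simp
  thus ?case by (auto intro!: exI[of _ 0])
next
  case (pCons a f)
  then obtain P where P: "\<And>x. x \<notin> S \<Longrightarrow> cauchy f x = poly f x * cauchy 1 x - poly P x" by blast
  show ?case
  proof (intro exI[of _ "pCons 0 P + [:I (poly f):]"] allI impI)
    fix x assume x: "x \<notin> S"
    have "cauchy (pCons a f) x = cauchy (smult a 1 + pCons 0 f) x"
      by (simp add: one_pCons)
    also have "\<dots> = a * cauchy 1 x + (x * cauchy f x - I (poly f))"
      by (simp only: cauchy_add[OF x] cauchy_smult[OF x] cauchy_shift[OF x])
    also have "\<dots> = poly (pCons a f) x * cauchy 1 x - poly (pCons 0 P + [:I (poly f):]) x"
      by (simp add: P[OF x] algebra_simps)
    finally show "cauchy (pCons a f) x = poly (pCons a f) x * cauchy 1 x - poly (pCons 0 P + [:I (poly f):]) x" .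
  qed
qed

lemma poly_bounded:
  obtains B where "\<And>y. y \<in> S \<Longrightarrow> norm (poly f y) \<le> B" "B \<ge> 0"
proof -
  have "bounded (poly f ` S)"
    using compact cont_poly compact_continuous_image compact_imp_bounded by blast
  then obtain B where "\<forall>y\<in>S. norm (poly f y) \<le> B" by (auto simp: bounded_iff)
  thus ?thesis using that[of "max B 0"] by fastforce
qed

lemma cauchy_le:
  obtains C where "\<And>x d. d > 0 \<Longrightarrow> (\<And>y. y \<in> S \<Longrightarrow> d \<le> norm (x - y)) \<Longrightarrow> norm (cauchy f x) \<le> C / d"
proof -
  obtain B where B: "\<And>y. y \<in> S \<Longrightarrow> norm (poly f y) \<le> B" "B \<ge> 0" using poly_bounded by blast
  obtain C where C: "\<And>f K. continuous_on S f \<Longrightarrow> (\<forall>y\<in>S. norm (f y) \<le> K) \<Longrightarrow> norm (I f) \<le> C * K"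
    using bound by blast
  show ?thesis
  proof (rule that[of "C * B"])
    fix x and d :: real assume d: "d > 0" "\<And>y. y \<in> S \<Longrightarrow> d \<le> norm (x - y)"
    have "x \<notin> S" using d by force
    moreover have "norm (poly f y / (x - y)) \<le> B / d" if "y \<in> S" for y
      using B d that by (auto simp: norm_divide intro!: frac_le)
    ultimately have "norm (cauchy f x) \<le> C * (B / d)"
      unfolding cauchy_def by (intro C cont_kernel) auto
    thus "norm (cauchy f x) \<le> C * B / d" by simp
  qed
qed

lemma cauchy_Bfun:
  assumes "x0 \<notin> S"
  shows "Bfun (cauchy f) (at x0)"
proof -
  obtain C where C: "\<And>x d. d > 0 \<Longrightarrow> (\<And>y. y \<in> S \<Longrightarrow> d \<le> norm (x - y)) \<Longrightarrow> norm (cauchy f x) \<le> C / d"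
    using cauchy_le by blast
  have "open (- S)" using compact compact_imp_closed by auto
  then obtain e where e: "e > 0" "ball x0 e \<subseteq> - S"
    using assms openE by blast
  have "norm (cauchy f x) \<le> C / (e/2)" if "dist x x0 < e/2" for x
  proof (rule C)
    fix y assume "y \<in> S"
    hence "dist x0 y \<ge> e" using e by force
    thus "e/2 \<le> norm (x - y)"
      using that dist_triangle[of x0 y x] by (simp add: dist_norm norm_minus_commute)
  qed (use e in auto)
  moreover have "eventually (\<lambda>x. dist x x0 < e/2) (at x0)"
    using e by (auto simp: eventually_at intro!: exI[of _ "e/2"])
  ultimately have "eventually (\<lambda>x. norm (cauchy f x) \<le> C / (e/2)) (at x0)"
    by (rule eventually_mono[rotated])
  thus ?thesis by (rule BfunI)
qed

lemma eventually_notin: "eventually (\<lambda>x. x \<notin> S) at_infinity"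
proof -
  obtain B where B: "\<And>y. y \<in> S \<Longrightarrow> norm y \<le> B"
    using compact_imp_bounded[OF compact] unfolding bounded_iff by blast
  thus ?thesis
    by (intro eventually_at_infinityI[of "B + 1"]) (smt (verit))
qed

lemma cauchy_tendsto_0: "(cauchy f \<longlongrightarrow> 0) at_infinity"
proof -
  obtain C where C: "\<And>x d. d > 0 \<Longrightarrow> (\<And>y. y \<in> S \<Longrightarrow> d \<le> norm (x - y)) \<Longrightarrow> norm (cauchy f x) \<le> C / d"
    using cauchy_le by blast
  obtain B where B: "\<And>y. y \<in> S \<Longrightarrow> norm y \<le> B"
    using compact_imp_bounded[OF compact] unfolding bounded_iff by blast
  have "eventually (\<lambda>x. norm (cauchy f x) \<le> norm (of_real (2 * C) * (1 / x ^ 1))) at_infinity"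
  proof (intro eventually_at_infinityI[of "2 * \<bar>B\<bar> + 1"])
    fix x :: complex assume x: "2 * \<bar>B\<bar> + 1 \<le> norm x"
    have "norm (cauchy f x) \<le> C / (norm x / 2)"
    proof (rule C)
      fix y assume "y \<in> S"
      thus "norm x / 2 \<le> norm (x - y)"
        using B[of y] norm_triangle_ineq2[of x y] x by linarith
    qed (use x in auto)
    also have "\<dots> = 2 * C / norm x" by simp
    also have "\<dots> \<le> \<bar>2 * C\<bar> / norm x"
      by (rule divide_right_mono[OF abs_ge_self norm_ge_zero])
    also have "\<dots> = norm (of_real (2 * C) * (1 / x ^ 1))"
      by (simp add: norm_mult norm_divide abs_mult)
    finally show "norm (cauchy f x) \<le> norm (of_real (2 * C) * (1 / x ^ 1))" .
  qed
  moreover have "((\<lambda>x. of_real (2 * C) * (1 / x ^ 1)) \<longlongrightarrow> (0::complex)) at_infinity"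
    by (rule tendsto_mult_right_zero, rule inverse_power_tendsto_0) simp
  ultimately show ?thesis
    by (rule Lim_null_comparison[OF _ tendsto_norm_zero])
qed

lemma cauchy_asymp:
  assumes "\<And>j. j < m \<Longrightarrow> I (poly (monom 1 j * f)) = 0"
  shows "((\<lambda>x. x ^ Suc m * cauchy f x) \<longlongrightarrow> I (poly (monom 1 m * f))) at_infinity"
proof -
  have eq: "x ^ k * cauchy f x = cauchy (monom 1 k * f) x" if "k \<le> m" "x \<notin> S" for k x
    using that
  proof (induction k)
    case (Suc k)
    have "monom 1 (Suc k) * f = pCons 0 (monom 1 k * f)"
      by (simp add: monom_Suc)
    thus ?case
      using Suc assms[of k] cauchy_shift[of x "monom 1 k * f"] by simp
  qed (simp flip: one_pCons add: monom_0)
  have "((\<lambda>x. I (poly (monom 1 m * f)) + cauchy (pCons 0 (monom 1 m * f)) x)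
          \<longlongrightarrow> I (poly (monom 1 m * f)) + 0) at_infinity"
    by (intro tendsto_intros cauchy_tendsto_0)
  moreover have "eventually (\<lambda>x. I (poly (monom 1 m * f)) + cauchy (pCons 0 (monom 1 m * f)) x
      = x ^ Suc m * cauchy f x) at_infinity"
    using eventually_notin
    by eventually_elim (simp add: eq[symmetric] cauchy_shift mult.assoc)
  ultimately have "((\<lambda>x. x ^ Suc m * cauchy f x) \<longlongrightarrow> I (poly (monom 1 m * f)) + 0) at_infinity"
    by (rule Lim_transform_eventually)
  thus ?thesis by simp
qed

end


locale orthonormal_system = bounded_functional +
  fixes p :: "nat \<Rightarrow> complex poly"
  assumes deg: "degree (p n) = n"
    and orth: "I (poly (p n * p m)) = (if n = m then 1 else 0)"
begin

lemma p_nonzero: "p n \<noteq> 0"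
  using orth[of n n] I_0 by auto

lemma lead_nonzero: "lead_coeff (p n) \<noteq> 0"
  using p_nonzero by simp

lemma I_lower: "degree r < n \<Longrightarrow> I (poly (r * p n)) = 0"
proof (induction "degree r" arbitrary: r rule: less_induct)
  case less
  define d where "d = degree r"
  define c where "c = lead_coeff r / lead_coeff (p d)"
  define r' where "r' = r - smult c (p d)"
  have cf: "coeff r' d = 0"
    using lead_nonzero[of d] by (simp add: r'_def c_def d_def deg)
  have "degree r' \<le> d" unfolding r'_def d_def
    by (intro degree_diff_le order.refl order.trans[OF degree_smult_le]) (simp add: deg)
  hence r': "degree r' < d \<or> r' = 0"
    using cf by (metis le_neq_implies_less leading_coeff_0_iff)
  have "I (poly (r' * p n)) = 0"
    using r'
  proof
    assume "degree r' < d"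
    thus ?thesis using less by (simp add: d_def)
  qed (simp add: I_0)
  moreover have "r * p n = smult c (p d * p n) + r' * p n"
    by (simp add: r'_def algebra_simps)
  ultimately show ?case
    using less.prems by (simp only: I_add I_smult orth) (simp add: d_def)
qed

lemma I_monom: "I (poly (monom 1 n * p n)) = 1 / lead_coeff (p n)"
proof -
  define r where "r = monom 1 n - smult (1 / lead_coeff (p n)) (p n)"
  have cf: "coeff r n = 0"
    using lead_nonzero[of n] by (simp add: r_def deg)
  have "degree r \<le> n" unfolding r_def
    by (intro degree_diff_le degree_monom_le order.trans[OF degree_smult_le]) (simp add: deg)
  hence "degree r < n \<or> r = 0"
    using cf by (metis le_neq_implies_less leading_coeff_0_iff)
  hence "I (poly (r * p n)) = 0"
    using I_lower I_0 by auto
  moreover have "monom 1 n * p n = r * p n + smult (1 / lead_coeff (p n)) (p n * p n)"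
    by (simp add: r_def algebra_simps)
  ultimately show ?thesis
    by (simp only: I_add I_smult orth) simp
qed

lemma second_kind_asymp:
  "((\<lambda>x. x ^ Suc n * cauchy (p n) x) \<longlongrightarrow> 1 / lead_coeff (p n)) at_infinity"
proof -
  have "I (poly (monom 1 j * p n)) = 0" if "j < n" for j
    using that by (intro I_lower) (simp add: degree_monom_eq)
  from cauchy_asymp[of n, OF this] show ?thesis by (simp only: I_monom)
qed

lemma p_asymp: "((\<lambda>x. poly (p n) x / x ^ n) \<longlongrightarrow> lead_coeff (p n)) at_infinity"
  using poly_divide_tendsto_aux[of "p n"] by (simp add: deg)

text \<open>The functions with index \<open>n - 1\<close>, including the convention for the index -1.\<close>

definition pm :: "nat \<Rightarrow> complex poly" where
  "pm n = (if n = 0 then 0 else p (n - 1))"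

definition qm :: "complex \<Rightarrow> nat \<Rightarrow> complex \<Rightarrow> complex" where
  "qm a0 n x = (if n = 0 then 1 / (a0 * lead_coeff (p 0)) else cauchy (p (n - 1)) x)"

lemma rec_coeff_nonzero: "a0 \<noteq> 0 \<Longrightarrow> rec_coeff a0 p n \<noteq> 0"
  using lead_nonzero by (simp add: rec_coeff_def)

lemma casorati_poly:
  assumes "n > 0"
    and P: "\<And>x. x \<notin> S \<Longrightarrow> cauchy (p n) x = poly (p n) x * cauchy 1 x - poly P x"
    and P': "\<And>x. x \<notin> S \<Longrightarrow> cauchy (p (n - 1)) x = poly (p (n - 1)) x * cauchy 1 x - poly P' x"
  shows "P * p (n - 1) - p n * P' = [:1 / rec_coeff a0 p n:]"
proof -
  define m where "m = n - 1"
  have n: "n = Suc m" using assms by (simp add: m_def)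
  let ?c = "1 / rec_coeff a0 p n"
  have eq: "poly (P * p m - p n * P') x =
      poly (p n) x * cauchy (p m) x - cauchy (p n) x * poly (p m) x" if "x \<notin> S" for x
    unfolding m_def P[OF that] P'[OF that] by (simp add: algebra_simps)
  have "((\<lambda>x. (poly (p n) x / x ^ n) * (x ^ Suc m * cauchy (p m) x)
      - (x ^ Suc n * cauchy (p n) x) * (poly (p m) x / x ^ m) * (1 / x ^ 2))
      \<longlongrightarrow> lead_coeff (p n) * (1 / lead_coeff (p m)) - 1 / lead_coeff (p n) * lead_coeff (p m) * 0) at_infinity"
    by (intro tendsto_intros second_kind_asymp p_asymp inverse_power_tendsto_0) simp
  moreover have "eventually (\<lambda>x. (poly (p n) x / x ^ n) * (x ^ Suc m * cauchy (p m) x)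
      - (x ^ Suc n * cauchy (p n) x) * (poly (p m) x / x ^ m) * (1 / x ^ 2)
      = poly (P * p m - p n * P') x) at_infinity"
    using eventually_notin eventually_not_equal_at_infinity[of 0]
    by eventually_elim (subst eq; simp add: n power2_eq_square)
  ultimately have "(poly (P * p m - p n * P') \<longlongrightarrow> lead_coeff (p n) * (1 / lead_coeff (p m))
      - 1 / lead_coeff (p n) * lead_coeff (p m) * 0) at_infinity"
    by (rule Lim_transform_eventually)
  hence "(poly (P * p m - p n * P') \<longlongrightarrow> ?c) at_infinity"
    by (simp add: rec_coeff_def n)
  from poly_const_of_limit[OF order.refl _ this] show ?thesis
    using at_infinity_minus_countable_neq_bot[of "{}"] by (simp add: m_def)
qed

lemma casorati:
  assumes "x \<notin> S" "a0 \<noteq> 0"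
  shows "poly (p n) x * qm a0 n x - cauchy (p n) x * poly (pm n) x = 1 / rec_coeff a0 p n"
proof (cases "n = 0")
  case True
  thus ?thesis using lead_nonzero[of 0] deg[of 0]
    by (auto simp: qm_def pm_def rec_coeff_def elim!: degree_eq_zeroE)
next
  case False
  obtain P where P: "\<And>x. x \<notin> S \<Longrightarrow> cauchy (p n) x = poly (p n) x * cauchy 1 x - poly P x"
    using cauchy_decomp by blast
  obtain P' where P': "\<And>x. x \<notin> S \<Longrightarrow> cauchy (p (n - 1)) x = poly (p (n - 1)) x * cauchy 1 x - poly P' x"
    using cauchy_decomp by blast
  have "P * p (n - 1) - p n * P' = [:1 / rec_coeff a0 p n:]"
    using False by (intro casorati_poly P P') auto
  hence "poly (P * p (n - 1) - p n * P') x = poly [:1 / rec_coeff a0 p n:] x" by (rule arg_cong)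
  hence "poly P x * poly (p (n - 1)) x - poly (p n) x * poly P' x = 1 / rec_coeff a0 p n" by simp
  thus ?thesis using False
    unfolding qm_def pm_def P[OF assms(1)] P'[OF assms(1)] by (simp add: algebra_simps)
qed

end

section \<open>The Thomae-Jackson functional\<close>

lemma convergent_prod_qpoch:
  assumes "norm q < 1"
  shows "convergent_prod (\<lambda>j. 1 - a * q ^ j :: complex)"
proof -
  have "summable (\<lambda>j. norm a * norm q ^ j)"
    using assms by (intro summable_mult summable_geometric) simp
  hence "summable (\<lambda>j. norm ((1 - a * q ^ j) - 1))"
    by (simp add: norm_mult norm_power)
  thus ?thesis
    by (intro abs_convergent_prod_imp_convergent_prod summable_imp_abs_convergent_prod)
qed

lemma qpoch_inf_step:
  assumes "norm q < 1"
  shows "qpoch_inf a q = (1 - a) * qpoch_inf (a * q) q"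
proof -
  have "(\<lambda>j. 1 - (a * q) * q ^ j) has_prod qpoch_inf (a * q) q"
    unfolding qpoch_inf_def by (intro convergent_prod_has_prod convergent_prod_qpoch assms)
  hence "(\<lambda>j. 1 - a * q ^ Suc j) has_prod qpoch_inf (a * q) q"
    by (simp add: mult.assoc)
  from has_prod_Suc_imp[of "\<lambda>j. 1 - a * q ^ j", OF this]
  have "(\<lambda>j. 1 - a * q ^ j) has_prod (qpoch_inf (a * q) q * (1 - a))" by simp
  from has_prod_unique[OF this] show ?thesis by (simp add: qpoch_inf_def mult.commute)
qed

lemma qpoch_inf_1: "norm q < 1 \<Longrightarrow> qpoch_inf 1 q = 0"
  using qpoch_inf_step[of q 1] by simp

lemma countable_qpoch_zeros:
  assumes "norm q < 1"
  shows "countable {x. qpoch_inf (c * x) q = 0}"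
proof (rule countable_subset)
  show "{x. qpoch_inf (c * x) q = 0} \<subseteq> range (\<lambda>j. 1 / (c * q ^ j))"
  proof safe
    fix x assume "qpoch_inf (c * x) q = 0"
    hence "\<not> (\<forall>j. 1 - c * x * q ^ j \<noteq> 0)"
      unfolding qpoch_inf_def using prodinf_nonzero[OF convergent_prod_qpoch[OF assms], of "c * x"] by blast
    then obtain j where "1 - c * x * q ^ j = 0" by blast
    hence "x * (c * q ^ j) = 1" by (simp add: algebra_simps)
    moreover from this have "c * q ^ j \<noteq> 0" by (intro notI) simp
    ultimately have "x = 1 / (c * q ^ j)" by (rule eq_divide_imp[rotated])
    thus "x \<in> range (\<lambda>j. 1 / (c * q ^ j))" by blast
  qed
qed simp

lemma q_lattice_isolated:
  fixes q c x :: complex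
  assumes "norm q < 1" "x \<noteq> 0"
  shows "finite {k. dist x (c * q ^ k) < norm x / 2}"
proof -
  have "(\<lambda>k. c * q ^ k) \<longlonglongrightarrow> c * 0"
    using assms(1) by (intro tendsto_mult tendsto_const LIMSEQ_power_zero)
  hence "(\<lambda>k. norm (c * q ^ k)) \<longlonglongrightarrow> 0"
    by (simp only: mult_zero_right tendsto_norm_zero_iff)
  moreover have "0 < norm x / 2" using assms(2) by simp
  ultimately have "eventually (\<lambda>k. norm (c * q ^ k) < norm x / 2) sequentially"
    by (rule order_tendstoD(2))
  then obtain K where K: "\<And>k. k \<ge> K \<Longrightarrow> norm (c * q ^ k) < norm x / 2"
    by (auto simp: eventually_sequentially)
  have "k < K" if "dist x (c * q ^ k) < norm x / 2" for k
  proof (rule ccontr)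
    assume "\<not> k < K"
    hence "norm (c * q ^ k) < norm x / 2" using K by simp
    moreover have "norm x - norm (c * q ^ k) < norm x / 2"
      using that norm_triangle_ineq2[of x "c * q ^ k"] by (simp add: dist_norm)
    ultimately show False by linarith
  qed
  thus ?thesis by (auto intro: finite_subset[of _ "{..<K}"])
qed

lemma bounded_q_lattice:
  fixes q c :: complex
  assumes "norm q < 1"
  shows "bounded (range (\<lambda>k. c * q ^ k))"
  unfolding bounded_iff
proof (intro exI ballI)
  fix y assume "y \<in> range (\<lambda>k. c * q ^ k)"
  then obtain k where "y = c * q ^ k" by blast
  thus "norm y \<le> norm c"
    using mult_left_le[of "norm q ^ k" "norm c"] power_le_one[of "norm q" k] assms
    by (simp add: norm_mult norm_power)
qed

lemma countable_q_support: "countable (q_support q G)"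
  by (simp add: q_support_def)

locale jackson_weight =
  fixes q s :: complex and b :: "nat \<Rightarrow> complex" and G :: "complex \<times> complex"
  assumes q_nz: "q \<noteq> 0" and q_lt_1: "norm q < 1" and b6: "b 6 \<noteq> 0" and s: "s \<noteq> 0"
begin

lemma weight_num_step: "b 6 * s * weight_num q b s x = D_minus b s x * weight_num q b s (q * x)"
  unfolding weight_num_def
  by (subst (1 2 3) qpoch_inf_step[OF q_lt_1])
     (use b6 s in \<open>simp add: D_minus_def field_simps\<close>)

lemma weight_den_step: "b 6 * s * weight_den q b s x = D_plus b s x * weight_den q b s (q * x)"
  unfolding weight_den_def
  by (subst (1 2 3) qpoch_inf_step[OF q_lt_1])
     (use b6 s in \<open>simp add: D_plus_def field_simps\<close>)

lemma weight_step:
  assumes "D_plus b s x \<noteq> 0"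
  shows "D_plus b s x * weight q b s x = D_minus b s x * weight q b s (q * x)"
proof -
  have "weight q b s x = (b 6 * s * weight_num q b s x) / (b 6 * s * weight_den q b s x)"
    using b6 s by (simp add: weight_def)
  thus ?thesis
    using assms by (simp add: weight_num_step weight_den_step weight_def)
qed

text \<open>The second point is a pole of the weight, where division by zero gives the value 0.\<close>

lemma weight_zeros: "weight q b s (b 6 * s) = 0" "weight q b s (s / b 6) = 0"
  using b6 s qpoch_inf_1[OF q_lt_1] by (simp_all add: weight_def weight_num_def weight_den_def)

definition singular :: "complex set" where
  "singular = q_support q G \<union> {x. q * x \<in> q_support q G}
     \<union> {x. weight_num q b s x = 0} \<union> {x. weight_den q b s x = 0}"

lemma countable_singular: "countable singular"
proof -
  have "{x. q * x \<in> q_support q G} = (\<lambda>y. y / q) ` q_support q G"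
    using q_nz by (auto simp: image_iff intro!: bexI[of _ "q * _"])
  moreover have "{x. weight_num q b s x = 0} \<subseteq> {x. qpoch_inf (b 2 * x) q = 0}
      \<union> {x. qpoch_inf (b 3 * x) q = 0} \<union> {x. qpoch_inf (inverse (b 6 * s) * x) q = 0}"
    by (auto simp: weight_num_def divide_inverse mult.commute)
  moreover have "{x. weight_den q b s x = 0} \<subseteq> {x. qpoch_inf (b 1 * x) q = 0}
      \<union> {x. qpoch_inf (b 4 * x) q = 0} \<union> {x. qpoch_inf ((b 6 / s) * x) q = 0}"
    by (auto simp: weight_den_def)
  ultimately show ?thesis
    unfolding singular_def
    by (metis countable_Un countable_image countable_q_support countable_qpoch_zeros[OF q_lt_1]
        countable_subset)
qed

lemma summable_weight: "summable (\<lambda>k. norm (q ^ k * weight q b s (c * q ^ k)))"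
proof -
  define h where "h k = D_plus b s (c * q ^ k) / D_minus b s (c * q ^ k)" for k
  have lat: "(\<lambda>k. c * q ^ k) \<longlonglongrightarrow> c * 0"
    using q_lt_1 by (intro tendsto_mult tendsto_const LIMSEQ_power_zero)
  have P: "(\<lambda>k. D_plus b s (c * q ^ k)) \<longlonglongrightarrow> b 6 * s"
    unfolding D_plus_def by (rule tendsto_eq_intros lat refl)+ simp
  have M: "(\<lambda>k. D_minus b s (c * q ^ k)) \<longlonglongrightarrow> b 6 * s"
    unfolding D_minus_def by (rule tendsto_eq_intros lat refl)+ simp
  have nz: "b 6 * s \<noteq> 0" using b6 s by simp
  have "(\<lambda>k. norm q * norm (h k)) \<longlonglongrightarrow> norm q * norm (b 6 * s / (b 6 * s))"
    unfolding h_def by (intro tendsto_intros P M nz)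
  hence "(\<lambda>k. norm q * norm (h k)) \<longlonglongrightarrow> norm q" using nz by simp
  moreover have "norm q < (1 + norm q) / 2" using q_lt_1 by simp
  ultimately have "eventually (\<lambda>k. norm q * norm (h k) < (1 + norm q) / 2) sequentially"
    by (rule order_tendstoD(2))
  moreover have "eventually (\<lambda>k. D_plus b s (c * q ^ k) \<noteq> 0) sequentially"
    by (rule tendsto_imp_eventually_ne[OF P nz])
  moreover have "eventually (\<lambda>k. D_minus b s (c * q ^ k) \<noteq> 0) sequentially"
    by (rule tendsto_imp_eventually_ne[OF M nz])
  ultimately have "eventually (\<lambda>k. norm q * norm (h k) < (1 + norm q) / 2
      \<and> D_plus b s (c * q ^ k) \<noteq> 0 \<and> D_minus b s (c * q ^ k) \<noteq> 0) sequentially"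
    by eventually_elim blast
  then obtain K where K: "\<And>k. k \<ge> K \<Longrightarrow> norm q * norm (h k) < (1 + norm q) / 2
      \<and> D_plus b s (c * q ^ k) \<noteq> 0 \<and> D_minus b s (c * q ^ k) \<noteq> 0"
    by (auto simp: eventually_sequentially)
  show ?thesis
  proof (rule summable_ratio_test)
    fix k assume "k \<ge> K"
    note k = K[OF this]
    have "weight q b s (c * q ^ Suc k) = h k * weight q b s (c * q ^ k)"
      using weight_step[of "c * q ^ k"] k by (simp add: h_def field_simps)
    hence "norm (q ^ Suc k * weight q b s (c * q ^ Suc k))
        = norm q * norm (h k) * norm (q ^ k * weight q b s (c * q ^ k))"
      by (simp add: norm_mult)
    also have "\<dots> \<le> (1 + norm q) / 2 * norm (q ^ k * weight q b s (c * q ^ k))"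
      using k by (intro mult_right_mono) auto
    finally show "norm (norm (q ^ Suc k * weight q b s (c * q ^ Suc k)))
        \<le> (1 + norm q) / 2 * norm (norm (q ^ k * weight q b s (c * q ^ k)))" by simp
  qed (use q_lt_1 in simp)
qed

text \<open>
  Lattice points of weight zero carry no mass; dropping them makes the Stieltjes function
  visibly regular there.
\<close>

definition carrier :: "complex set" where
  "carrier = insert 0 {y \<in> q_support q G. weight q b s y \<noteq> 0}"

definition jint :: "(complex \<Rightarrow> complex) \<Rightarrow> complex" where
  "jint f = q_integral q G (\<lambda>y. weight q b s y * f y)"

lemma carrier_subset: "carrier \<subseteq> q_support q G"
  by (auto simp: carrier_def q_support_def)

lemma compact_carrier: "compact carrier"
proof (rule compact_of_isolated_points)
  have "bounded (q_support q G)"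
    unfolding q_support_def using bounded_q_lattice[OF q_lt_1] by simp
  thus "bounded carrier" using carrier_subset bounded_subset by blast
  show "0 \<in> carrier" by (simp add: carrier_def)
  fix x :: complex assume x: "x \<noteq> 0"
  let ?A = "\<lambda>c. (\<lambda>k. c * q ^ k) ` {k. dist x (c * q ^ k) < norm x / 2}"
  have "finite (?A (fst G) \<union> ?A (snd G))"
    using q_lattice_isolated[OF q_lt_1 x] by blast
  then obtain d where d: "d > 0" "\<forall>y\<in>?A (fst G) \<union> ?A (snd G). y \<noteq> x \<longrightarrow> d \<le> dist x y"
    using finite_set_avoid[of _ x] by blast
  show "\<exists>d>0. \<forall>y\<in>carrier. y \<noteq> x \<longrightarrow> d \<le> dist x y"
  proof (intro exI[of _ "min d (norm x / 2)"] conjI ballI impI)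
    fix y assume y: "y \<in> carrier" "y \<noteq> x"
    show "min d (norm x / 2) \<le> dist x y"
    proof (cases "dist x y < norm x / 2")
      case True
      hence "y \<in> ?A (fst G) \<union> ?A (snd G)"
        using y(1) carrier_subset x by (auto simp: q_support_def)
      thus ?thesis using d y by force
    qed auto
  qed (use d x in auto)
qed

lemma half_integral:
  assumes c: "\<And>k. c * q ^ k \<in> q_support q G"
    and K: "\<And>y. y \<in> carrier \<Longrightarrow> norm (f y) \<le> K"
  shows "summable (\<lambda>k. q ^ k * (weight q b s (c * q ^ k) * f (c * q ^ k)))"
    and "norm (\<Sum>k. q ^ k * (weight q b s (c * q ^ k) * f (c * q ^ k)))
      \<le> (\<Sum>k. norm (q ^ k * weight q b s (c * q ^ k))) * K"
proof -
  have le: "norm (q ^ k * (weight q b s (c * q ^ k) * f (c * q ^ k)))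
      \<le> norm (q ^ k * weight q b s (c * q ^ k)) * K" for k
  proof (cases "weight q b s (c * q ^ k) = 0")
    case False
    hence "norm (f (c * q ^ k)) \<le> K" using K c by (simp add: carrier_def)
    thus ?thesis by (simp add: norm_mult mult_left_mono mult.assoc)
  qed simp
  have sm: "summable (\<lambda>k. norm (q ^ k * weight q b s (c * q ^ k)) * K)"
    by (intro summable_mult2 summable_weight)
  have sn: "summable (\<lambda>k. norm (q ^ k * (weight q b s (c * q ^ k) * f (c * q ^ k))))"
    by (rule summable_comparison_test'[OF sm]) (use le in simp)
  show "summable (\<lambda>k. q ^ k * (weight q b s (c * q ^ k) * f (c * q ^ k)))"
    using sn by (rule summable_norm_cancel)
  have "norm (\<Sum>k. q ^ k * (weight q b s (c * q ^ k) * f (c * q ^ k)))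
      \<le> (\<Sum>k. norm (q ^ k * (weight q b s (c * q ^ k) * f (c * q ^ k))))"
    by (rule summable_norm[OF sn])
  also have "\<dots> \<le> (\<Sum>k. norm (q ^ k * weight q b s (c * q ^ k)) * K)"
    by (intro suminf_le le sn sm)
  also have "\<dots> = (\<Sum>k. norm (q ^ k * weight q b s (c * q ^ k))) * K"
    by (rule suminf_mult2[OF summable_weight, symmetric])
  finally show "norm (\<Sum>k. q ^ k * (weight q b s (c * q ^ k) * f (c * q ^ k)))
      \<le> (\<Sum>k. norm (q ^ k * weight q b s (c * q ^ k))) * K" .
qed

lemma lattice_in_support: "fst G * q ^ k \<in> q_support q G" "snd G * q ^ k \<in> q_support q G"
  by (auto simp: q_support_def)

lemma cont_bounded:
  assumes "continuous_on carrier f"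
  obtains K where "\<And>y. y \<in> carrier \<Longrightarrow> norm (f y) \<le> K"
proof -
  have "bounded (f ` carrier)"
    using assms compact_carrier compact_continuous_image compact_imp_bounded by blast
  thus ?thesis using that unfolding bounded_iff by blast
qed

sublocale functional: bounded_functional carrier jint
proof
  show "compact carrier" by (rule compact_carrier)
next
  fix f g :: "complex \<Rightarrow> complex"
  assume "continuous_on carrier f" "continuous_on carrier g"
  then obtain K L where K: "\<And>y. y \<in> carrier \<Longrightarrow> norm (f y) \<le> K"
    and L: "\<And>y. y \<in> carrier \<Longrightarrow> norm (g y) \<le> L"
    using cont_bounded by metis
  have "(\<Sum>k. q ^ k * (weight q b s (c * q ^ k) * (f (c * q ^ k) + g (c * q ^ k))))
      = (\<Sum>k. q ^ k * (weight q b s (c * q ^ k) * f (c * q ^ k)))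
      + (\<Sum>k. q ^ k * (weight q b s (c * q ^ k) * g (c * q ^ k)))"
    if "\<And>k. c * q ^ k \<in> q_support q G" for c
    using suminf_add[OF half_integral(1)[where f = f, OF that K] half_integral(1)[where f = g, OF that L]]
    by (simp add: distrib_left)
  thus "jint (\<lambda>y. f y + g y) = jint f + jint g"
    unfolding jint_def q_integral_def by (simp add: lattice_in_support algebra_simps)
next
  fix f :: "complex \<Rightarrow> complex" and a
  assume "continuous_on carrier f"
  then obtain K where K: "\<And>y. y \<in> carrier \<Longrightarrow> norm (f y) \<le> K" using cont_bounded by metis
  have "(\<Sum>k. q ^ k * (weight q b s (c * q ^ k) * (a * f (c * q ^ k))))
      = a * (\<Sum>k. q ^ k * (weight q b s (c * q ^ k) * f (c * q ^ k)))"
    if "\<And>k. c * q ^ k \<in> q_support q G" for c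
    using suminf_mult[OF half_integral(1)[where f = f, OF that K], of a] by (simp add: ac_simps)
  thus "jint (\<lambda>y. a * f y) = a * jint f"
    unfolding jint_def q_integral_def by (simp add: lattice_in_support algebra_simps)
next
  let ?N = "\<lambda>c. \<Sum>k. norm (q ^ k * weight q b s (c * q ^ k))"
  show "\<exists>C. \<forall>f K. continuous_on carrier f \<longrightarrow> (\<forall>y\<in>carrier. norm (f y) \<le> K) \<longrightarrow> norm (jint f) \<le> C * K"
  proof (intro exI allI impI)
    fix f :: "complex \<Rightarrow> complex" and K
    assume "\<forall>y\<in>carrier. norm (f y) \<le> K"
    hence K: "\<And>y. y \<in> carrier \<Longrightarrow> norm (f y) \<le> K" by blast
    let ?H = "\<lambda>c. \<Sum>k. q ^ k * (weight q b s (c * q ^ k) * f (c * q ^ k))"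
    have "norm (jint f) \<le> norm ((1 - q) * snd G) * norm (?H (snd G)) + norm ((1 - q) * fst G) * norm (?H (fst G))"
      unfolding jint_def q_integral_def norm_mult[symmetric] by (rule norm_triangle_ineq4)
    also have "\<dots> \<le> norm ((1 - q) * snd G) * (?N (snd G) * K) + norm ((1 - q) * fst G) * (?N (fst G) * K)"
      by (intro add_mono mult_left_mono half_integral(2)[where f = f, OF _ K] lattice_in_support norm_ge_zero)
    also have "\<dots> = (norm ((1 - q) * snd G) * ?N (snd G) + norm ((1 - q) * fst G) * ?N (fst G)) * K"
      by (simp only: distrib_right mult.assoc)
    finally show "norm (jint f) \<le> \<dots>" .
  qed
next
  fix f h :: "complex \<Rightarrow> complex"
  assume "\<And>y. y \<in> carrier \<Longrightarrow> f y = h y"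
  hence *: "weight q b s y * f y = weight q b s y * h y" if "y \<in> q_support q G" for y
    using that by (cases "weight q b s y = 0") (auto simp: carrier_def)
  show "jint f = jint h"
    unfolding jint_def q_integral_def by (simp only: *[OF lattice_in_support(1)] *[OF lattice_in_support(2)])
qed

lemma stieltjes_eq: "stieltjes q b G s x = functional.cauchy 1 x"
  by (simp add: stieltjes_def functional.cauchy_def jint_def)

lemma second_kind_eq: "second_kind q b G s p n x = functional.cauchy (p n) x"
  by (simp add: second_kind_def functional.cauchy_def jint_def)

lemma orthonormal_system_of_orthonormal_polys:
  assumes "orthonormal_polys q b G s p"
  shows "orthonormal_system carrier jint p"
proof
  fix n m
  show "degree (p n) = n" using assms by (simp add: orthonormal_polys_def)
  show "jint (poly (p n * p m)) = (if n = m then 1 else 0)"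
    using assms by (simp add: orthonormal_polys_def jint_def mult.assoc)
qed

end

section \<open>The spectral matrix\<close>

lemma eq_of_eq_off_countable:
  fixes f h :: "complex \<Rightarrow> complex"
  assumes N: "countable N" and f: "continuous_on UNIV f" and h: "continuous_on UNIV h"
    and eq: "\<And>y. y \<notin> N \<Longrightarrow> f y = h y"
  shows "f = h"
proof
  fix x
  let ?F = "at x within (- N)"
  have "(f \<longlongrightarrow> f x) ?F" "(h \<longlongrightarrow> h x) ?F"
    using f h by (auto simp: continuous_on_def intro: tendsto_within_subset)
  moreover have "eventually (\<lambda>y. f y = h y) ?F"
    using eq by (auto simp: eventually_at_filter)
  ultimately show "f x = h x"
    using at_within_minus_countable_neq_bot[OF N] by (metis tendsto_cong tendsto_unique)
qed

lemma scale_at_infinity: "q \<noteq> 0 \<Longrightarrow> filterlim (\<lambda>x::complex. q * x) at_infinity at_infinity"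
  by (intro tendsto_mult_filterlim_at_infinity[of _ q] tendsto_const filterlim_ident)

lemma scale_at:
  fixes q x0 :: complex
  assumes "q \<noteq> 0"
  shows "filterlim (\<lambda>x. q * x) (at (q * x0)) (at x0)"
  unfolding filterlim_at using assms
  by (auto simp: eventually_at_filter intro!: tendsto_intros)

lemma Bfun_scale:
  fixes q x0 :: complex and f :: "complex \<Rightarrow> complex"
  assumes "q \<noteq> 0" "Bfun f (at (q * x0))"
  shows "Bfun (\<lambda>x. f (q * x)) (at x0)"
proof -
  from assms(2) obtain K where "eventually (\<lambda>x. norm (f x) \<le> K) (at (q * x0))"
    by (auto elim: BfunE)
  hence "eventually (\<lambda>x. norm (f (q * x)) \<le> K) (at x0)"
    using scale_at[OF assms(1)] by (rule eventually_compose_filterlim)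
  thus ?thesis by (rule BfunI)
qed

lemma Bfun_mult_tendsto:
  fixes f h :: "complex \<Rightarrow> complex"
  assumes "(f \<longlongrightarrow> l) F" "Bfun h F"
  shows "Bfun (\<lambda>x. f x * h x) F"
proof -
  obtain K where K: "K > 0" "eventually (\<lambda>x. norm (h x) \<le> K) F"
    using assms(2) by (elim BfunE)
  have "eventually (\<lambda>x. norm (f x) < norm l + 1) F"
    using order_tendstoD(2)[OF tendsto_norm[OF assms(1)], of "norm l + 1"] by simp
  with K(2) have "eventually (\<lambda>x. norm (f x * h x) \<le> (norm l + 1) * K) F"
    by eventually_elim (simp add: norm_mult mult_mono)
  thus ?thesis by (rule BfunI)
qed

lemma Bfun_diff:
  fixes f h :: "complex \<Rightarrow> complex"
  assumes "Bfun f F" "Bfun h F"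
  shows "Bfun (\<lambda>x. f x - h x) F"
proof -
  obtain K L where "eventually (\<lambda>x. norm (f x) \<le> K) F" "eventually (\<lambda>x. norm (h x) \<le> L) F"
    using assms by (elim BfunE)
  hence "eventually (\<lambda>x. norm (f x - h x) \<le> K + L) F"
    by eventually_elim (meson add_mono norm_triangle_ineq4 order_trans)
  thus ?thesis by (rule BfunI)
qed

lemma D_plus_asymp: "((\<lambda>x. D_plus b s x / x ^ 3) \<longlongrightarrow> - (b 1 * b 4 * (b 6)\<^sup>2)) at_infinity"
proof -
  let ?P = "smult (b 6) ([:1, - b 1:] * [:1, - b 4:] * [:s, - b 6:])"
  have "degree ?P \<le> 3"
    by (intro order.trans[OF degree_smult_le] order.trans[OF degree_mult_le]
        order.trans[OF add_mono[OF degree_mult_le order.refl]]) simp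
  from poly_coeff_tendsto[OF this]
  have "((\<lambda>x. poly ?P x / x ^ 3) \<longlongrightarrow> coeff ?P 3) at_infinity" .
  moreover have "poly ?P = D_plus b s" by (auto simp: D_plus_def algebra_simps)
  moreover have "coeff ?P 3 = - (b 1 * b 4 * (b 6)\<^sup>2)"
    by (simp add: eval_nat_numeral)
  ultimately show ?thesis by (simp only:)
qed

lemma D_minus_asymp: "((\<lambda>x. D_minus b s x / x ^ 3) \<longlongrightarrow> - (b 2 * b 3)) at_infinity"
proof -
  let ?P = "[:1, - b 2:] * [:1, - b 3:] * [:b 6 * s, - 1:]"
  have "degree ?P \<le> 3"
    by (intro order.trans[OF degree_mult_le]
        order.trans[OF add_mono[OF degree_mult_le order.refl]]) simp
  from poly_coeff_tendsto[OF this]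
  have "((\<lambda>x. poly ?P x / x ^ 3) \<longlongrightarrow> coeff ?P 3) at_infinity" .
  moreover have "poly ?P = D_minus b s" by (auto simp: D_minus_def algebra_simps)
  moreover have "coeff ?P 3 = - (b 2 * b 3)"
    by (simp add: eval_nat_numeral)
  ultimately show ?thesis by (simp only:)
qed

lemma continuous_D: "continuous_on A (D_plus b s)" "continuous_on A (D_minus b s)"
  unfolding D_plus_def[abs_def] D_minus_def[abs_def] by (intro continuous_intros)+

locale jackson_spectral = jackson_weight +
  fixes p :: "nat \<Rightarrow> complex poly" and a0 :: complex and U :: "complex poly"
  assumes orthonormal: "orthonormal_polys q b G s p"
    and a0: "a0 \<noteq> 0"
    and stieltjes_x: "\<And>x. x \<notin> q_support q G \<Longrightarrow> q * x \<notin> q_support q G \<Longrightarrow>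
          D_minus b s x * stieltjes q b G s (q * x)
            = D_plus b s x * stieltjes q b G s x + (q - 1) * x * poly U x"
begin

sublocale sys: orthonormal_system carrier jint p
  by (rule orthonormal_system_of_orthonormal_polys[OF orthonormal])

abbreviation "\<phi> \<equiv> functional.cauchy 1"
abbreviation "Q n \<equiv> functional.cauchy (p n)"
abbreviation "Qm \<equiv> sys.qm a0"
abbreviation "a n \<equiv> rec_coeff a0 p n"

lemma a_nonzero: "a n \<noteq> 0"
  by (rule sys.rec_coeff_nonzero[OF a0])

lemma notin_carrier:
  assumes "x \<notin> singular" shows "x \<notin> carrier" "q * x \<notin> carrier"
  using assms carrier_subset by (auto simp: singular_def)

lemma phi_step:
  "x \<notin> singular \<Longrightarrow> D_minus b s x * \<phi> (q * x) = D_plus b s x * \<phi> x + (q - 1) * x * poly U x"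
  using stieltjes_x[of x] by (simp add: singular_def stieltjes_eq)

lemma D_nonzero:
  assumes "x \<notin> singular"
  shows "D_plus b s x \<noteq> 0" "D_minus b s x \<noteq> 0" "weight q b s x \<noteq> 0" "weight q b s (q * x) \<noteq> 0"
proof -
  have "weight_num q b s x \<noteq> 0" "weight_den q b s x \<noteq> 0"
    using assms by (simp_all add: singular_def)
  hence *: "D_minus b s x \<noteq> 0 \<and> weight_num q b s (q * x) \<noteq> 0"
      "D_plus b s x \<noteq> 0 \<and> weight_den q b s (q * x) \<noteq> 0"
      "weight q b s x \<noteq> 0"
    using weight_num_step[of x] weight_den_step[of x] b6 s by (auto simp: weight_def)
  thus "D_plus b s x \<noteq> 0" "D_minus b s x \<noteq> 0" "weight q b s x \<noteq> 0" "weight q b s (q * x) \<noteq> 0"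
    by (auto simp: weight_def)
qed

lemma casorati: "x \<notin> carrier \<Longrightarrow>
    poly (p n) x * Qm n x - Q n x * poly (sys.pm n) x = 1 / a n"
  by (rule sys.casorati[OF _ a0])

lemma pm_Qm_Suc [simp]: "sys.pm (Suc n) = p n" "Qm (Suc n) = Q n"
  by (simp_all add: sys.pm_def sys.qm_def fun_eq_iff)

context
  fixes n :: nat and Wp Tp Tm Wm :: "complex poly"
  assumes spectral: "is_spectral_matrix q b G s a0 p n (vector [vector [Wp, - Tp], vector [Tm, Wm]])"
begin

lemma spectral_rows:
  assumes x: "x \<notin> singular"
  shows "D_plus b s x * poly (p n) (q * x) = poly Wp x * poly (p n) x - poly Tp x * poly (sys.pm n) x"
    and "D_minus b s x * Q n (q * x) = poly Wp x * Q n x - poly Tp x * Qm n x"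
    and "D_plus b s x * poly (sys.pm n) (q * x) = poly Tm x * poly (p n) x + poly Wm x * poly (sys.pm n) x"
    and "D_minus b s x * Qm n (q * x) = poly Tm x * Q n x + poly Wm x * Qm n x"
proof -
  let ?w = "weight q b s x" and ?w' = "weight q b s (q * x)"
  let ?Y = "Y_matrix q b G s a0 p n" and ?A = "vector [vector [Wp, - Tp], vector [Tm, Wm]] :: complex poly ^ 2 ^ 2"
  have "map_matrix (\<lambda>y. D_plus b s x * y) (?Y (q * x)) = map_matrix (\<lambda>P. poly P x) ?A ** ?Y x"
    using spectral x by (simp add: is_spectral_matrix_def singular_def)
  hence "map_matrix (\<lambda>y. D_plus b s x * y) (?Y (q * x)) $ i $ j = (map_matrix (\<lambda>P. poly P x) ?A ** ?Y x) $ i $ j" for i j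
    by simp
  hence *: "D_plus b s x * ?Y (q * x) $ i $ j = poly (?A $ i $ 1) x * ?Y x $ 1 $ j + poly (?A $ i $ 2) x * ?Y x $ 2 $ j" for i j
    by (simp add: map_matrix_def matrix_matrix_mult_def sum_2)
  have Y: "?Y y $ 1 $ 1 = poly (p n) y" "?Y y $ 1 $ 2 = Q n y / weight q b s y"
    "?Y y $ 2 $ 1 = poly (sys.pm n) y" "?Y y $ 2 $ 2 = Qm n y / weight q b s y" for y
    by (simp_all add: Y_matrix_def sys.pm_def sys.qm_def second_kind_eq)
  have A: "?A $ 1 $ 1 = Wp" "?A $ 1 $ 2 = - Tp" "?A $ 2 $ 1 = Tm" "?A $ 2 $ 2 = Wm"
    by simp_all
  note nz = D_nonzero[OF x]
  have w: "D_plus b s x / ?w' = D_minus b s x / ?w"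
    using weight_step[OF nz(1)] nz by (simp add: field_simps)
  show "D_plus b s x * poly (p n) (q * x) = poly Wp x * poly (p n) x - poly Tp x * poly (sys.pm n) x"
    using *[of 1 1] by (simp only: Y A) simp
  show "D_plus b s x * poly (sys.pm n) (q * x) = poly Tm x * poly (p n) x + poly Wm x * poly (sys.pm n) x"
    using *[of 2 1] by (simp only: Y A)
  have "D_plus b s x / ?w' * Q n (q * x) = (poly Wp x * Q n x - poly Tp x * Qm n x) / ?w"
    using *[of 1 2] by (simp only: Y A) (simp add: diff_divide_distrib)
  thus "D_minus b s x * Q n (q * x) = poly Wp x * Q n x - poly Tp x * Qm n x"
    unfolding w using nz by (simp add: divide_simps split: if_splits)
  have "D_plus b s x / ?w' * Qm n (q * x) = (poly Tm x * Q n x + poly Wm x * Qm n x) / ?w"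
    using *[of 2 2] by (simp only: Y A) (simp add: add_divide_distrib)
  thus "D_minus b s x * Qm n (q * x) = poly Tm x * Q n x + poly Wm x * Qm n x"
    unfolding w using nz by (simp add: divide_simps split: if_splits)
qed

lemma spectral_entries:
  assumes x: "x \<notin> singular"
  shows "poly Wp x = a n * (D_plus b s x * poly (p n) (q * x) * Qm n x - D_minus b s x * Q n (q * x) * poly (sys.pm n) x)"
    and "poly Tp x = a n * (D_plus b s x * poly (p n) (q * x) * Q n x - D_minus b s x * Q n (q * x) * poly (p n) x)"
    and "poly Tm x = a n * (D_plus b s x * poly (sys.pm n) (q * x) * Qm n x - D_minus b s x * Qm n (q * x) * poly (sys.pm n) x)"
    and "poly Wm x = a n * (D_minus b s x * Qm n (q * x) * poly (p n) x - D_plus b s x * poly (sys.pm n) (q * x) * Q n x)"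
proof -
  have c: "a n * (poly (p n) x * Qm n x - Q n x * poly (sys.pm n) x) = 1"
    using casorati[OF notin_carrier(1)[OF x], of n] a_nonzero by simp
  have mult: "P = a n * E" if "E = P * (poly (p n) x * Qm n x - Q n x * poly (sys.pm n) x)" for P E
  proof -
    have "a n * E = P * (a n * (poly (p n) x * Qm n x - Q n x * poly (sys.pm n) x))"
      unfolding that by (simp only: ac_simps)
    thus ?thesis by (simp only: c mult_1_right)
  qed
  show "poly Wp x = a n * (D_plus b s x * poly (p n) (q * x) * Qm n x - D_minus b s x * Q n (q * x) * poly (sys.pm n) x)"
    "poly Tp x = a n * (D_plus b s x * poly (p n) (q * x) * Q n x - D_minus b s x * Q n (q * x) * poly (p n) x)"
    "poly Tm x = a n * (D_plus b s x * poly (sys.pm n) (q * x) * Qm n x - D_minus b s x * Qm n (q * x) * poly (sys.pm n) x)"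
    "poly Wm x = a n * (D_minus b s x * Qm n (q * x) * poly (p n) x - D_plus b s x * poly (sys.pm n) (q * x) * Q n x)"
    by (rule mult, simp only: spectral_rows[OF x], algebra)+
qed

lemma spectral_det: "(\<lambda>x. poly Wp x * poly Wm x + poly Tp x * poly Tm x) = (\<lambda>x. D_plus b s x * D_minus b s x)"
proof (rule eq_of_eq_off_countable[OF countable_singular])
  fix x assume x: "x \<notin> singular"
  note c = casorati[OF notin_carrier(1)[OF x], of n] casorati[OF notin_carrier(2)[OF x], of n]
  have "(poly Wp x * poly Wm x + poly Tp x * poly Tm x) * (poly (p n) x * Qm n x - Q n x * poly (sys.pm n) x)
    = (poly Wp x * poly (p n) x - poly Tp x * poly (sys.pm n) x) * (poly Tm x * Q n x + poly Wm x * Qm n x)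
    - (poly Wp x * Q n x - poly Tp x * Qm n x) * (poly Tm x * poly (p n) x + poly Wm x * poly (sys.pm n) x)"
    by algebra
  also have "\<dots> = D_plus b s x * D_minus b s x * (poly (p n) (q * x) * Qm n (q * x) - Q n (q * x) * poly (sys.pm n) (q * x))"
    unfolding spectral_rows[OF x, symmetric] by algebra
  finally show "poly Wp x * poly Wm x + poly Tp x * poly Tm x = D_plus b s x * D_minus b s x"
    using a_nonzero by (simp only: c) simp
qed (intro continuous_intros continuous_D)+

end

lemma D_zero: "D_plus b s 0 = b 6 * s" "D_minus b s 0 = b 6 * s"
  by (simp_all add: D_plus_def D_minus_def)

text \<open>The Stieltjes relation removes the transcendental part of the matrix entries.\<close>

lemma bilinear_value_at_0:
  assumes Pu: "\<And>x. x \<notin> carrier \<Longrightarrow> functional.cauchy u x = poly u x * \<phi> x - poly Pu x"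
    and Pv: "\<And>x. x \<notin> carrier \<Longrightarrow> functional.cauchy v x = poly v x * \<phi> x - poly Pv x"
    and R: "\<And>x. x \<notin> singular \<Longrightarrow> poly R x = c *
        (D_plus b s x * poly u (q * x) * functional.cauchy v x
          - D_minus b s x * functional.cauchy u (q * x) * poly v x)"
  shows "poly R 0 = c * b 6 * s * poly (Pu * v - u * Pv) 0"
proof -
  have "poly R = (\<lambda>x. c * ((1 - q) * x * poly U x * poly u (q * x) * poly v x
      - D_plus b s x * poly u (q * x) * poly Pv x + D_minus b s x * poly Pu (q * x) * poly v x))"
  proof (rule eq_of_eq_off_countable[OF countable_singular])
    fix x assume x: "x \<notin> singular"
    show "poly R x = c * ((1 - q) * x * poly U x * poly u (q * x) * poly v x
      - D_plus b s x * poly u (q * x) * poly Pv x + D_minus b s x * poly Pu (q * x) * poly v x)"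
      using phi_step[OF x]
      unfolding R[OF x] Pu[OF notin_carrier(2)[OF x]] Pv[OF notin_carrier(1)[OF x]]
      by algebra
  qed (intro continuous_intros continuous_D)+
  from fun_cong[OF this, of 0] show ?thesis by (simp add: D_zero algebra_simps)
qed

definition "inf_filter = inf at_infinity (principal (- singular))"

lemma inf_filter: "inf_filter \<le> at_infinity" "inf_filter \<noteq> bot"
  unfolding inf_filter_def using at_infinity_minus_countable_neq_bot[OF countable_singular] by auto

lemma eventually_inf_filter: "eventually (\<lambda>x. x \<notin> singular \<and> x \<noteq> 0) inf_filter"
  unfolding inf_filter_def eventually_inf_principal
  using eventually_not_equal_at_infinity[of 0] by eventually_elim simp

lemma asymp:
  shows "((\<lambda>x. poly (p k) x / x ^ k) \<longlongrightarrow> lead_coeff (p k)) at_infinity"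
    and "((\<lambda>x. x ^ Suc k * Q k x) \<longlongrightarrow> 1 / lead_coeff (p k)) at_infinity"
    and "((\<lambda>x. poly (p k) (q * x) / x ^ k) \<longlongrightarrow> lead_coeff (p k) * q ^ k) at_infinity"
    and "((\<lambda>x. x ^ Suc k * Q k (q * x)) \<longlongrightarrow> 1 / (lead_coeff (p k) * q ^ Suc k)) at_infinity"
proof -
  show 1: "((\<lambda>x. poly (p k) x / x ^ k) \<longlongrightarrow> lead_coeff (p k)) at_infinity" by (rule sys.p_asymp)
  show 2: "((\<lambda>x. x ^ Suc k * Q k x) \<longlongrightarrow> 1 / lead_coeff (p k)) at_infinity" by (rule sys.second_kind_asymp)
  have "((\<lambda>x. poly (p k) (q * x) / (q * x) ^ k * q ^ k) \<longlongrightarrow> lead_coeff (p k) * q ^ k) at_infinity"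
    by (intro tendsto_mult tendsto_const filterlim_compose[OF 1 scale_at_infinity[OF q_nz]])
  thus "((\<lambda>x. poly (p k) (q * x) / x ^ k) \<longlongrightarrow> lead_coeff (p k) * q ^ k) at_infinity"
    using q_nz by (simp add: power_mult_distrib)
  have "((\<lambda>x. (q * x) ^ Suc k * Q k (q * x) * (1 / q ^ Suc k)) \<longlongrightarrow> 1 / lead_coeff (p k) * (1 / q ^ Suc k)) at_infinity"
    by (intro tendsto_mult tendsto_const filterlim_compose[OF 2 scale_at_infinity[OF q_nz]])
  thus "((\<lambda>x. x ^ Suc k * Q k (q * x)) \<longlongrightarrow> 1 / (lead_coeff (p k) * q ^ Suc k)) at_infinity"
    using q_nz by (simp add: power_mult_distrib mult.assoc)
qed

lemma Tp_shape:
  assumes spec: "is_spectral_matrix q b G s a0 p n (vector [vector [Wp, - Tp], vector [Tm, Wm]])"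
  shows "degree Tp \<le> 2" "coeff Tp 2 = a n * (b 2 * b 3 / q ^ Suc n - b 1 * b 4 * (b 6)\<^sup>2 * q ^ n)"
    "poly Tp 0 = 0"
proof -
  define \<gamma> where "\<gamma> = lead_coeff (p n)"
  have \<gamma>: "\<gamma> \<noteq> 0" using sys.lead_nonzero by (simp add: \<gamma>_def)
  note A = asymp[of n, folded \<gamma>_def]
  have "((\<lambda>x. a n * ((D_plus b s x / x ^ 3) * (poly (p n) (q * x) / x ^ n) * (x ^ Suc n * Q n x)
        - (D_minus b s x / x ^ 3) * (x ^ Suc n * Q n (q * x)) * (poly (p n) x / x ^ n)))
      \<longlongrightarrow> a n * (- (b 1 * b 4 * (b 6)\<^sup>2) * (\<gamma> * q ^ n) * (1 / \<gamma>) - - (b 2 * b 3) * (1 / (\<gamma> * q ^ Suc n)) * \<gamma>)) inf_filter"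
    by (rule tendsto_mono[OF inf_filter(1)])
       (intro tendsto_mult tendsto_const tendsto_diff D_plus_asymp D_minus_asymp A)
  moreover have "eventually (\<lambda>x. a n * ((D_plus b s x / x ^ 3) * (poly (p n) (q * x) / x ^ n) * (x ^ Suc n * Q n x)
        - (D_minus b s x / x ^ 3) * (x ^ Suc n * Q n (q * x)) * (poly (p n) x / x ^ n)) = poly Tp x / x ^ 2) inf_filter"
    using eventually_inf_filter
    by eventually_elim (simp add: spectral_entries[OF spec] field_simps eval_nat_numeral)
  ultimately have "((\<lambda>x. poly Tp x / x ^ 2) \<longlongrightarrow>
      a n * (- (b 1 * b 4 * (b 6)\<^sup>2) * (\<gamma> * q ^ n) * (1 / \<gamma>) - - (b 2 * b 3) * (1 / (\<gamma> * q ^ Suc n)) * \<gamma>)) inf_filter"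
    by (rule Lim_transform_eventually)
  moreover have "a n * (- (b 1 * b 4 * (b 6)\<^sup>2) * (\<gamma> * q ^ n) * (1 / \<gamma>) - - (b 2 * b 3) * (1 / (\<gamma> * q ^ Suc n)) * \<gamma>)
      = a n * (b 2 * b 3 / q ^ Suc n - b 1 * b 4 * (b 6)\<^sup>2 * q ^ n)"
    using \<gamma> by simp
  ultimately have "((\<lambda>x. poly Tp x / x ^ 2) \<longlongrightarrow> a n * (b 2 * b 3 / q ^ Suc n - b 1 * b 4 * (b 6)\<^sup>2 * q ^ n)) inf_filter"
    by (simp only:)
  from poly_coeff_limit[OF inf_filter this]
  show "degree Tp \<le> 2" "coeff Tp 2 = a n * (b 2 * b 3 / q ^ Suc n - b 1 * b 4 * (b 6)\<^sup>2 * q ^ n)" .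
  obtain P where P: "\<And>x. x \<notin> carrier \<Longrightarrow> Q n x = poly (p n) x * \<phi> x - poly P x"
    using functional.cauchy_decomp by blast
  have "poly Tp 0 = a n * b 6 * s * poly (P * p n - p n * P) 0"
    by (rule bilinear_value_at_0[OF P P spectral_entries(2)[OF spec]])
  thus "poly Tp 0 = 0" by simp
qed

lemma Tm_eq_Tp:
  assumes spec: "is_spectral_matrix q b G s a0 p (Suc m) (vector [vector [Wp, - Tp], vector [Tm, Wm]])"
    and spec': "is_spectral_matrix q b G s a0 p m (vector [vector [Wp', - Tp'], vector [Tm', Wm']])"
  shows "Tm = smult (a (Suc m) / a m) Tp'"
proof (rule poly_eq_off_countable[OF countable_singular])
  fix x assume x: "x \<notin> singular"
  show "poly Tm x = poly (smult (a (Suc m) / a m) Tp') x"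
    using a_nonzero[of m] by (simp add: spectral_entries(3)[OF spec x] spectral_entries(2)[OF spec' x])
qed

lemma W_shape:
  assumes spec: "is_spectral_matrix q b G s a0 p (Suc m) (vector [vector [Wp, - Tp], vector [Tm, Wm]])"
  shows "degree Wp \<le> 3" "coeff Wp 3 = - (b 1 * b 4 * (b 6)\<^sup>2 * q ^ Suc m)" "poly Wp 0 = b 6 * s"
    "degree Wm \<le> 3" "coeff Wm 3 = - (b 2 * b 3 / q ^ Suc m)" "poly Wm 0 = b 6 * s"
proof -
  let ?n = "Suc m"
  define \<gamma> \<delta> where "\<gamma> = lead_coeff (p ?n)" and "\<delta> = lead_coeff (p m)"
  have nz: "\<gamma> \<noteq> 0" "\<delta> \<noteq> 0" using sys.lead_nonzero by (simp_all add: \<gamma>_def \<delta>_def)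
  have an: "a ?n = \<delta> / \<gamma>" by (simp add: rec_coeff_def \<gamma>_def \<delta>_def)
  note A = asymp[of ?n, folded \<gamma>_def] and B = asymp[of m, folded \<delta>_def]
  have z: "((\<lambda>x::complex. 1 / x ^ 2) \<longlongrightarrow> 0) at_infinity" by (rule inverse_power_tendsto_0) simp
  note entries = spectral_entries[OF spec, unfolded pm_Qm_Suc]
  have "((\<lambda>x. a ?n * ((D_plus b s x / x ^ 3) * (poly (p ?n) (q * x) / x ^ ?n) * (x ^ Suc m * Q m x)
        - (D_minus b s x / x ^ 3) * (x ^ Suc ?n * Q ?n (q * x)) * (poly (p m) x / x ^ m) * (1 / x ^ 2)))
      \<longlongrightarrow> a ?n * (- (b 1 * b 4 * (b 6)\<^sup>2) * (\<gamma> * q ^ ?n) * (1 / \<delta>)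
          - - (b 2 * b 3) * (1 / (\<gamma> * q ^ Suc ?n)) * \<delta> * 0)) inf_filter"
    by (rule tendsto_mono[OF inf_filter(1)])
       (intro tendsto_mult tendsto_const tendsto_diff D_plus_asymp D_minus_asymp A B z)
  moreover have "eventually (\<lambda>x. a ?n * ((D_plus b s x / x ^ 3) * (poly (p ?n) (q * x) / x ^ ?n) * (x ^ Suc m * Q m x)
        - (D_minus b s x / x ^ 3) * (x ^ Suc ?n * Q ?n (q * x)) * (poly (p m) x / x ^ m) * (1 / x ^ 2))
      = poly Wp x / x ^ 3) inf_filter"
    using eventually_inf_filter
    by eventually_elim (simp add: entries field_simps eval_nat_numeral)
  ultimately have "((\<lambda>x. poly Wp x / x ^ 3) \<longlongrightarrow> a ?n * (- (b 1 * b 4 * (b 6)\<^sup>2) * (\<gamma> * q ^ ?n) * (1 / \<delta>)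
          - - (b 2 * b 3) * (1 / (\<gamma> * q ^ Suc ?n)) * \<delta> * 0)) inf_filter"
    by (rule Lim_transform_eventually)
  from poly_coeff_limit[OF inf_filter this]
  show "degree Wp \<le> 3" "coeff Wp 3 = - (b 1 * b 4 * (b 6)\<^sup>2 * q ^ ?n)" using nz by (simp_all add: an)
  have "((\<lambda>x. a ?n * ((D_minus b s x / x ^ 3) * (x ^ Suc m * Q m (q * x)) * (poly (p ?n) x / x ^ ?n)
        - (D_plus b s x / x ^ 3) * (poly (p m) (q * x) / x ^ m) * (x ^ Suc ?n * Q ?n x) * (1 / x ^ 2)))
      \<longlongrightarrow> a ?n * (- (b 2 * b 3) * (1 / (\<delta> * q ^ Suc m)) * \<gamma>
          - - (b 1 * b 4 * (b 6)\<^sup>2) * (\<delta> * q ^ m) * (1 / \<gamma>) * 0)) inf_filter"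
    by (rule tendsto_mono[OF inf_filter(1)])
       (intro tendsto_mult tendsto_const tendsto_diff D_plus_asymp D_minus_asymp A B z)
  moreover have "eventually (\<lambda>x. a ?n * ((D_minus b s x / x ^ 3) * (x ^ Suc m * Q m (q * x)) * (poly (p ?n) x / x ^ ?n)
        - (D_plus b s x / x ^ 3) * (poly (p m) (q * x) / x ^ m) * (x ^ Suc ?n * Q ?n x) * (1 / x ^ 2))
      = poly Wm x / x ^ 3) inf_filter"
    using eventually_inf_filter
    by eventually_elim (simp add: entries field_simps eval_nat_numeral)
  ultimately have "((\<lambda>x. poly Wm x / x ^ 3) \<longlongrightarrow> a ?n * (- (b 2 * b 3) * (1 / (\<delta> * q ^ Suc m)) * \<gamma>
          - - (b 1 * b 4 * (b 6)\<^sup>2) * (\<delta> * q ^ m) * (1 / \<gamma>) * 0)) inf_filter"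
    by (rule Lim_transform_eventually)
  from poly_coeff_limit[OF inf_filter this]
  show "degree Wm \<le> 3" "coeff Wm 3 = - (b 2 * b 3 / q ^ ?n)" using nz by (simp_all add: an)
  obtain P where P: "\<And>x. x \<notin> carrier \<Longrightarrow> Q ?n x = poly (p ?n) x * \<phi> x - poly P x"
    using functional.cauchy_decomp by blast
  obtain P' where P': "\<And>x. x \<notin> carrier \<Longrightarrow> Q m x = poly (p m) x * \<phi> x - poly P' x"
    using functional.cauchy_decomp by blast
  have C: "P * p m - p ?n * P' = [:1 / a ?n:]"
    using sys.casorati_poly[of ?n P P' a0] P P' by simp
  have "poly Wp 0 = a ?n * b 6 * s * poly (P * p m - p ?n * P') 0"
    by (rule bilinear_value_at_0[OF P P' entries(1)])
  thus "poly Wp 0 = b 6 * s" unfolding C using a_nonzero by simp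
  have R: "poly Wm x = - a ?n * (D_plus b s x * poly (p m) (q * x) * Q ?n x
      - D_minus b s x * Q m (q * x) * poly (p ?n) x)" if "x \<notin> singular" for x
    unfolding entries(4)[OF that] by algebra
  have "poly Wm 0 = - a ?n * b 6 * s * poly (P' * p ?n - p m * P) 0"
    by (rule bilinear_value_at_0[OF P' P R])
  also have "P' * p ?n - p m * P = - (P * p m - p ?n * P')" by (simp add: algebra_simps)
  finally show "poly Wm 0 = b 6 * s" unfolding C using a_nonzero by simp
qed

end

section \<open>The deformation in t\<close>

lemma countable_scale_preimage:
  fixes q :: complex
  assumes "q \<noteq> 0" "countable S"
  shows "countable {x. q * x \<in> S}"
proof (rule countable_subset)
  show "{x. q * x \<in> S} \<subseteq> (\<lambda>y. y / q) ` S"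
    using assms(1) by (auto simp: image_iff intro!: bexI[of _ "q * _"])
qed (use assms in simp)

lemma linear_asymp: "((\<lambda>x::complex. (c + d * x) / x) \<longlongrightarrow> d) at_infinity"
  using poly_coeff_tendsto[of "[:c, d:]" 1] by (simp add: mult.commute)

lemma quadratic_asymp:
  "((\<lambda>x::complex. (1 - c * x) * (1 - d * x) / x ^ 2) \<longlongrightarrow> c * d) at_infinity"
proof -
  have "((\<lambda>x. ((1 + (- c) * x) / x) * ((1 + (- d) * x) / x)) \<longlongrightarrow> (- c) * (- d)) at_infinity"
    by (intro tendsto_mult linear_asymp)
  thus ?thesis by (simp add: power2_eq_square)
qed

lemma poly_scale: "poly (pcompose u [:0, q:]) x = poly u (q * x :: complex)"
  by (simp add: poly_pcompose mult.commute)

locale t_evolution =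
  A: jackson_spectral q t b G p a0 U + B: jackson_spectral q "q * t" b G' p' a0' U'
  for q t b G p a0 U G' p' a0' U' +
  fixes T :: "complex poly"
  assumes stieltjes_t: "\<And>x. x \<notin> q_support q G \<Longrightarrow> x \<notin> q_support q G' \<Longrightarrow>
      E_minus q b t x * stieltjes q b G' (q * t) x
        = E_plus q b t x * stieltjes q b G t x + (q - 1) * t * poly T x"
begin

abbreviation "E_m \<equiv> E_minus q b t"
abbreviation "E_p \<equiv> E_plus q b t"

definition bad :: "complex set" where
  "bad = A.singular \<union> B.singular \<union> {x. q * x \<in> A.singular} \<union> {x. q * x \<in> B.singular}
    \<union> {b 6 * t, t / b 6}"

lemma countable_bad: "countable bad"
  unfolding bad_def
  by (intro countable_Un A.countable_singular B.countable_singular countable_scale_preimage A.q_nz) simp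

lemma notin_bad:
  assumes "x \<notin> bad"
  shows "x \<notin> A.singular" "x \<notin> B.singular" "q * x \<notin> A.singular" "q * x \<notin> B.singular"
    "b 6 * t - x \<noteq> 0" "t - b 6 * x \<noteq> 0"
  using A.b6 assms by (auto simp: bad_def field_simps)

lemma phi_t_step:
  assumes "x \<notin> A.singular" "x \<notin> B.singular"
  shows "E_m x * B.\<phi> x = E_p x * A.\<phi> x + (q - 1) * t * poly T x"
  using stieltjes_t[of x] assms
  by (simp add: A.singular_def B.singular_def A.stieltjes_eq B.stieltjes_eq)

lemma bilinear_t_poly:
  "\<exists>R. \<forall>x. x \<notin> A.singular \<longrightarrow> x \<notin> B.singular \<longrightarrow>
    poly R x = E_m x * B.functional.cauchy u x * poly v x - E_p x * poly u x * A.functional.cauchy v x"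
proof -
  obtain Pu where Pu: "\<And>x. x \<notin> B.carrier \<Longrightarrow> B.functional.cauchy u x = poly u x * B.\<phi> x - poly Pu x"
    using B.functional.cauchy_decomp by blast
  obtain Pv where Pv: "\<And>x. x \<notin> A.carrier \<Longrightarrow> A.functional.cauchy v x = poly v x * A.\<phi> x - poly Pv x"
    using A.functional.cauchy_decomp by blast
  define R where "R = smult ((q - 1) * t) (T * u * v) - [:q * t, - b 6:] * Pu * v
    + smult (inverse (b 6)) ([:b 6 * q * t, - 1:] * u * Pv)"
  have "poly R x = E_m x * B.functional.cauchy u x * poly v x - E_p x * poly u x * A.functional.cauchy v x"
    if x: "x \<notin> A.singular" "x \<notin> B.singular" for x
  proof -
    have "poly R x = (q - 1) * t * poly T x * poly u x * poly v x - E_m x * poly Pu x * poly v x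
        + E_p x * poly u x * poly Pv x"
      by (simp add: R_def E_minus_def E_plus_def mult.assoc) algebra
    thus ?thesis
      using phi_t_step[OF x]
      unfolding Pu[OF B.notin_carrier(1)[OF x(2)]] Pv[OF A.notin_carrier(1)[OF x(1)]]
      by algebra
  qed
  thus ?thesis by blast
qed

abbreviation "Quad s x \<equiv> (s - b 6 * x) * (b 6 * s - x)"

text \<open>
  A priori only \<open>Quad t x\<close> times the left-hand side is polynomial. But the weight vanishes at the
  zeros of \<open>Quad\<close>, so both Stieltjes functions are regular there. This replaces the usual
  divisibility argument, which would need these zeros to be disjoint from those of
  \<open>Quad (q * t)\<close>.
\<close>

lemma phi_qt_poly:
  "\<exists>V. \<forall>x. x \<notin> bad \<longrightarrow>
    poly V x = (1 - b 2 * x) * (1 - b 3 * x) * B.\<phi> (q * x) - (1 - b 1 * x) * (1 - b 4 * x) * A.\<phi> x"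
proof -
  define h where "h x = (1 - b 2 * x) * (1 - b 3 * x) * B.\<phi> (q * x) - (1 - b 1 * x) * (1 - b 4 * x) * A.\<phi> x" for x
  define k where "k = q / b 6"
  define R where "R = smult (q - 1) ([:0, 1:] * smult k [:b 6 * t, - 1:] * U
    + smult t ([:1, - b 2:] * [:1, - b 3:] * [:b 6 * t, - 1:] * pcompose T [:0, q:]))"
  have R: "poly R x = (- b 6 * x + t) * ((b 6 * t - x) * (q * h x))" if x: "x \<notin> bad" for x
  proof -
    note n = notin_bad[OF x]
    have Ep: "E_p (q * x) = k * (b 6 * t - x)" and Em: "E_m (q * x) = q * (t - b 6 * x)"
      using A.b6 by (simp_all add: k_def E_plus_def E_minus_def field_simps)
    have "poly R x = (q - 1) * (x * E_p (q * x) * poly U x + t * D_minus b t x * poly T (q * x))"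
      unfolding Ep by (simp add: R_def D_minus_def poly_scale) algebra
    also have "\<dots> = D_minus b t x * E_m (q * x) * B.\<phi> (q * x) - D_plus b t x * E_p (q * x) * A.\<phi> x"
      using A.phi_step[OF n(1)] phi_t_step[OF n(3,4)] by algebra
    also have "\<dots> = D_minus b t x * (q * (t - b 6 * x)) * B.\<phi> (q * x)
        - ((1 - b 1 * x) * (1 - b 4 * x) * (t - b 6 * x)) * (q * (b 6 * t - x)) * A.\<phi> x"
      unfolding Ep Em D_plus_def k_def using A.b6 by simp
    also have "\<dots> = (- b 6 * x + t) * ((b 6 * t - x) * (q * h x))"
      unfolding D_minus_def h_def by algebra
    finally show ?thesis .
  qed
  have bdd: "Bfun h (at x0)" if "x0 \<notin> A.carrier" "q * x0 \<notin> B.carrier" for x0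
    unfolding h_def
    by (intro Bfun_diff Bfun_mult_tendsto[of _ "(1 - b 2 * x0) * (1 - b 3 * x0)"]
        Bfun_mult_tendsto[of _ "(1 - b 1 * x0) * (1 - b 4 * x0)"] tendsto_intros
        Bfun_scale A.q_nz A.functional.cauchy_Bfun B.functional.cauchy_Bfun that)
  have zeros: "b 6 * t \<notin> A.carrier" "t / b 6 \<notin> A.carrier" "q * (b 6 * t) \<notin> B.carrier" "q * (t / b 6) \<notin> B.carrier"
    using A.weight_zeros B.weight_zeros A.b6 A.s A.q_nz
    by (auto simp: A.carrier_def B.carrier_def mult.left_commute)
  have "\<exists>R1. R = [:t, - b 6:] * R1"
  proof (rule poly_dvd_of_bounded[OF countable_bad _ R])
    have "- t / - b 6 = t / b 6" by simp
    thus "Bfun (\<lambda>x. (b 6 * t - x) * (q * h x)) (at (- t / - b 6))"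
      using zeros by (auto intro!: Bfun_mult_tendsto tendsto_intros bdd)
  qed (use A.b6 in simp)
  then obtain R1 where R1: "R = [:t, - b 6:] * R1" by blast
  have R1x: "poly R1 x = (- 1 * x + b 6 * t) * (q * h x)" if x: "x \<notin> bad" for x
  proof -
    have "(t - b 6 * x) * poly R1 x = (t - b 6 * x) * ((b 6 * t - x) * (q * h x))"
      using R[OF x] unfolding R1 by (simp add: algebra_simps)
    thus ?thesis using notin_bad(6)[OF x] by simp
  qed
  have "\<exists>R2. R1 = [:b 6 * t, - 1:] * R2"
  proof (rule poly_dvd_of_bounded[OF countable_bad _ R1x])
    show "Bfun (\<lambda>x. q * h x) (at (- (b 6 * t) / - 1))"
      using zeros by (auto intro!: Bfun_mult_tendsto tendsto_intros bdd)
  qed simp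
  then obtain R2 where R2: "R1 = [:b 6 * t, - 1:] * R2" by blast
  have "poly (smult (1 / q) R2) x = h x" if x: "x \<notin> bad" for x
  proof -
    have "(b 6 * t - x) * poly R2 x = (b 6 * t - x) * (q * h x)"
      using R1x[OF x] unfolding R2 by (simp add: algebra_simps)
    thus ?thesis using notin_bad(5)[OF x] A.q_nz by simp
  qed
  thus ?thesis unfolding h_def by blast
qed

lemma bilinear_qt_poly:
  "\<exists>R. \<forall>x. x \<notin> bad \<longrightarrow>
    poly R x = (1 - b 2 * x) * (1 - b 3 * x) * B.functional.cauchy u (q * x) * poly v x
      - (1 - b 1 * x) * (1 - b 4 * x) * poly u (q * x) * A.functional.cauchy v x"
proof -
  obtain Pu where Pu: "\<And>x. x \<notin> B.carrier \<Longrightarrow> B.functional.cauchy u x = poly u x * B.\<phi> x - poly Pu x"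
    using B.functional.cauchy_decomp by blast
  obtain Pv where Pv: "\<And>x. x \<notin> A.carrier \<Longrightarrow> A.functional.cauchy v x = poly v x * A.\<phi> x - poly Pv x"
    using A.functional.cauchy_decomp by blast
  obtain V where V: "\<And>x. x \<notin> bad \<Longrightarrow>
      poly V x = (1 - b 2 * x) * (1 - b 3 * x) * B.\<phi> (q * x) - (1 - b 1 * x) * (1 - b 4 * x) * A.\<phi> x"
    using phi_qt_poly by blast
  define R where "R = pcompose u [:0, q:] * v * V
    - [:1, - b 2:] * [:1, - b 3:] * pcompose Pu [:0, q:] * v
    + [:1, - b 1:] * [:1, - b 4:] * pcompose u [:0, q:] * Pv"
  have "poly R x = (1 - b 2 * x) * (1 - b 3 * x) * B.functional.cauchy u (q * x) * poly v x
      - (1 - b 1 * x) * (1 - b 4 * x) * poly u (q * x) * A.functional.cauchy v x"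
    if x: "x \<notin> bad" for x
  proof -
    note n = notin_bad[OF x]
    have "poly R x = poly u (q * x) * poly v x * poly V x
        - (1 - b 2 * x) * (1 - b 3 * x) * poly Pu (q * x) * poly v x
        + (1 - b 1 * x) * (1 - b 4 * x) * poly u (q * x) * poly Pv x"
      by (simp add: R_def poly_scale) algebra
    thus ?thesis
      unfolding Pu[OF B.notin_carrier(1)[OF n(4)]] Pv[OF A.notin_carrier(1)[OF n(1)]] V[OF x]
      by algebra
  qed
  thus ?thesis by blast
qed

definition "inf_filter = inf at_infinity (principal (- bad))"

lemma inf_filter: "inf_filter \<le> at_infinity" "inf_filter \<noteq> bot"
  unfolding inf_filter_def using at_infinity_minus_countable_neq_bot[OF countable_bad] by auto

lemma eventually_inf_filter: "eventually (\<lambda>x. x \<notin> bad \<and> x \<noteq> 0) inf_filter"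
  unfolding inf_filter_def eventually_inf_principal
  using eventually_not_equal_at_infinity[of 0] by eventually_elim simp

lemma E_asymp: "((\<lambda>x. E_m x / x) \<longlongrightarrow> - b 6) at_infinity"
    "((\<lambda>x. E_p x / x) \<longlongrightarrow> - inverse (b 6)) at_infinity"
proof -
  have "E_m = (\<lambda>x. q * t + (- b 6) * x)" "E_p = (\<lambda>x. q * t + (- inverse (b 6)) * x)"
    using A.b6 by (auto simp: E_minus_def E_plus_def field_simps)
  thus "((\<lambda>x. E_m x / x) \<longlongrightarrow> - b 6) at_infinity" "((\<lambda>x. E_p x / x) \<longlongrightarrow> - inverse (b 6)) at_infinity"
    by (simp_all only: linear_asymp)
qed

lemma evolution_at_root:
  assumes spec: "is_spectral_matrix q b G t a0 p (Suc m) (vector [vector [Wp, - Tp], vector [Tm, Wm]])"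
    and spec': "is_spectral_matrix q b G' (q * t) a0' p' (Suc m) (vector [vector [Wp', - Tp'], vector [Tm', Wm']])"
    and Tp: "Tp \<noteq> 0" "poly Tp g = 0" "g \<noteq> 0" "Quad t g \<noteq> 0"
    and Tp': "poly Tp' g' = 0" "g' \<noteq> 0" "Quad (q * t) g' \<noteq> 0"
    and Wp': "q * t * poly Wp' g' = Quad (q * t) g' * (1 - f * g')"
  shows "t * poly Wm g = Quad t g * (1 - f * g)"
proof -
  let ?n = "Suc m"
  define \<gamma> \<delta> \<gamma>' where "\<gamma> = lead_coeff (p ?n)" and "\<delta> = lead_coeff (p m)" and "\<gamma>' = lead_coeff (p' ?n)"
  have nz: "\<gamma> \<noteq> 0" "\<delta> \<noteq> 0" "\<gamma>' \<noteq> 0"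
    using A.sys.lead_nonzero B.sys.lead_nonzero by (simp_all add: \<gamma>_def \<delta>_def \<gamma>'_def)
  note asymp_rules = A.asymp[of ?n, folded \<gamma>_def] A.asymp[of m, folded \<delta>_def] B.asymp[of ?n, folded \<gamma>'_def]
    E_asymp quadratic_asymp inverse_power_tendsto_0[of 2, simplified]
  note eA = A.spectral_entries[OF spec, unfolded A.pm_Qm_Suc]
    and eB = B.spectral_entries[OF spec', unfolded B.pm_Qm_Suc]
  let ?a = "A.a ?n"
  have a: "?a \<noteq> 0" by (rule A.a_nonzero)

  obtain B12 where B12: "\<And>x. x \<notin> A.singular \<Longrightarrow> x \<notin> B.singular \<Longrightarrow>
      poly B12 x = E_m x * B.Q ?n x * poly (p ?n) x - E_p x * poly (p' ?n) x * A.Q ?n x"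
    using bilinear_t_poly by blast
  obtain B11 where B11: "\<And>x. x \<notin> A.singular \<Longrightarrow> x \<notin> B.singular \<Longrightarrow>
      poly B11 x = E_m x * B.Q ?n x * poly (p m) x - E_p x * poly (p' ?n) x * A.Q m x"
    using bilinear_t_poly by blast
  obtain B22 where B22: "\<And>x. x \<notin> A.singular \<Longrightarrow> x \<notin> B.singular \<Longrightarrow>
      poly B22 x = E_m x * B.Q m x * poly (p ?n) x - E_p x * poly (p' m) x * A.Q ?n x"
    using bilinear_t_poly by blast
  obtain L where L: "\<And>x. x \<notin> bad \<Longrightarrow>
      poly L x = (1 - b 2 * x) * (1 - b 3 * x) * B.Q ?n (q * x) * poly (p ?n) x
      - (1 - b 1 * x) * (1 - b 4 * x) * poly (p' ?n) (q * x) * A.Q ?n x"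
    using bilinear_qt_poly by blast

  obtain \<beta> where \<beta>: "B12 = [:\<beta>:]"
  proof -
    define c where "c = - b 6 * (1 / \<gamma>') * \<gamma> - - inverse (b 6) * \<gamma>' * (1 / \<gamma>)"
    have "((\<lambda>x. (E_m x / x) * (x ^ Suc ?n * B.Q ?n x) * (poly (p ?n) x / x ^ ?n)
        - (E_p x / x) * (poly (p' ?n) x / x ^ ?n) * (x ^ Suc ?n * A.Q ?n x)) \<longlongrightarrow> c) inf_filter"
      unfolding c_def by (rule tendsto_mono[OF inf_filter(1)]) (intro tendsto_mult tendsto_diff asymp_rules)
    moreover have "eventually (\<lambda>x. (E_m x / x) * (x ^ Suc ?n * B.Q ?n x) * (poly (p ?n) x / x ^ ?n)
        - (E_p x / x) * (poly (p' ?n) x / x ^ ?n) * (x ^ Suc ?n * A.Q ?n x) = poly B12 x) inf_filter"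
      using eventually_inf_filter
      by eventually_elim (simp add: B12 notin_bad field_simps)
    ultimately have "(poly B12 \<longlongrightarrow> c) inf_filter" by (rule Lim_transform_eventually)
    from poly_const_of_limit[OF inf_filter this] that show ?thesis by blast
  qed

  have B11_nz: "B11 \<noteq> 0"
  proof
    assume "B11 = 0"
    define c where "c = - b 6 * (1 / \<gamma>') * \<delta> * 0 - - inverse (b 6) * \<gamma>' * (1 / \<delta>)"
    have "((\<lambda>x. (E_m x / x) * (x ^ Suc ?n * B.Q ?n x) * (poly (p m) x / x ^ m) * (1 / x ^ 2)
        - (E_p x / x) * (poly (p' ?n) x / x ^ ?n) * (x ^ Suc m * A.Q m x)) \<longlongrightarrow> c) inf_filter"
      unfolding c_def by (rule tendsto_mono[OF inf_filter(1)]) (intro tendsto_mult tendsto_diff asymp_rules)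
    moreover have "eventually (\<lambda>x. (E_m x / x) * (x ^ Suc ?n * B.Q ?n x) * (poly (p m) x / x ^ m) * (1 / x ^ 2)
        - (E_p x / x) * (poly (p' ?n) x / x ^ ?n) * (x ^ Suc m * A.Q m x) = poly B11 x / x ^ 1) inf_filter"
      using eventually_inf_filter
      by eventually_elim (simp add: B11 notin_bad field_simps eval_nat_numeral)
    ultimately have "((\<lambda>x. poly B11 x / x ^ 1) \<longlongrightarrow> c) inf_filter" by (rule Lim_transform_eventually)
    from poly_coeff_limit(2)[OF inf_filter this] \<open>B11 = 0\<close> have "c = 0" by simp
    thus False using nz A.b6 by (simp add: c_def)
  qed

  obtain l0 l1 where l: "L = [:l0, l1:]"
  proof -
    define c where "c = b 2 * b 3 * (1 / (\<gamma>' * q ^ Suc ?n)) * \<gamma> - b 1 * b 4 * (\<gamma>' * q ^ ?n) * (1 / \<gamma>)"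
    have "((\<lambda>x. ((1 - b 2 * x) * (1 - b 3 * x) / x ^ 2) * (x ^ Suc ?n * B.Q ?n (q * x)) * (poly (p ?n) x / x ^ ?n)
        - ((1 - b 1 * x) * (1 - b 4 * x) / x ^ 2) * (poly (p' ?n) (q * x) / x ^ ?n) * (x ^ Suc ?n * A.Q ?n x)) \<longlongrightarrow> c) inf_filter"
      unfolding c_def by (rule tendsto_mono[OF inf_filter(1)]) (intro tendsto_mult tendsto_diff asymp_rules)
    moreover have "eventually (\<lambda>x. ((1 - b 2 * x) * (1 - b 3 * x) / x ^ 2) * (x ^ Suc ?n * B.Q ?n (q * x)) * (poly (p ?n) x / x ^ ?n)
        - ((1 - b 1 * x) * (1 - b 4 * x) / x ^ 2) * (poly (p' ?n) (q * x) / x ^ ?n) * (x ^ Suc ?n * A.Q ?n x)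
        = poly L x / x ^ 1) inf_filter"
      using eventually_inf_filter
    proof eventually_elim
      case (elim x)
      hence "x \<noteq> 0" "x \<notin> bad" by auto
      have red: "c / x ^ 2 * (x ^ Suc ?n * d) * (e / x ^ ?n) = c * d * e / x" for c d e
        using \<open>x \<noteq> 0\<close> by (simp add: field_simps power2_eq_square)
      have red': "c / x ^ 2 * (e / x ^ ?n) * (x ^ Suc ?n * d) = c * e * d / x" for c d e
        using \<open>x \<noteq> 0\<close> by (simp add: field_simps power2_eq_square)
      show ?case unfolding red red' L[OF \<open>x \<notin> bad\<close>] by (simp add: diff_divide_distrib)
    qed
    ultimately have "((\<lambda>x. poly L x / x ^ 1) \<longlongrightarrow> c) inf_filter" by (rule Lim_transform_eventually)
    from poly_coeff_limit(1)[OF inf_filter this] have "degree L \<le> 1" .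
    hence "degree (L - [:coeff L 0, coeff L 1:]) \<le> 1" "coeff (L - [:coeff L 0, coeff L 1:]) 1 = 0"
      "coeff (L - [:coeff L 0, coeff L 1:]) 0 = 0"
      by (auto intro!: degree_diff_le)
    hence "L - [:coeff L 0, coeff L 1:] = 0"
      by (metis leading_coeff_0_iff le_Suc_eq le_zero_eq One_nat_def)
    thus ?thesis using that by simp
  qed

  have at_t: "(\<lambda>x. \<beta> * poly Wm x + poly B11 (q * x) * poly Tp x) = (\<lambda>x. q * Quad t x * poly L x)"
  proof (rule eq_of_eq_off_countable[OF countable_bad])
    fix x assume x: "x \<notin> bad"
    note n = notin_bad[OF x]
    define P P1 Z Z1 P' Z' where "P = poly (p ?n) (q * x)" and "P1 = poly (p m) (q * x)"
      and "Z = A.Q ?n (q * x)" and "Z1 = A.Q m (q * x)" and "P' = poly (p' ?n) (q * x)" and "Z' = B.Q ?n (q * x)"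
    define y z where "y = poly (p ?n) x" and "z = A.Q ?n x"
    note defs = P_def P1_def Z_def Z1_def P'_def Z'_def y_def z_def
    have cas: "?a * (P * Z1 - Z * P1) = 1"
      using A.casorati[OF A.notin_carrier(1)[OF n(3)], of ?n] a by (simp add: defs)
    have b12: "\<beta> = E_m (q * x) * Z' * P - E_p (q * x) * P' * Z"
      using B12[OF n(3,4)] by (simp add: \<beta> defs)
    have b11: "poly B11 (q * x) = E_m (q * x) * Z' * P1 - E_p (q * x) * P' * Z1"
      using B11[OF n(3,4)] by (simp add: defs)
    have wm: "poly Wm x = ?a * (D_minus b t x * Z1 * y - D_plus b t x * P1 * z)"
      unfolding eA(4)[OF n(1)] defs ..
    have tp: "poly Tp x = ?a * (D_plus b t x * P * z - D_minus b t x * Z * y)"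
      unfolding eA(2)[OF n(1)] defs ..
    have Ep: "E_p (q * x) * D_plus b t x = q * Quad t x * ((1 - b 1 * x) * (1 - b 4 * x))"
      using A.b6 by (simp add: E_plus_def D_plus_def field_simps)
    have Em: "E_m (q * x) * D_minus b t x = q * Quad t x * ((1 - b 2 * x) * (1 - b 3 * x))"
      by (simp add: E_minus_def D_minus_def algebra_simps)
    have "\<beta> * poly Wm x + poly B11 (q * x) * poly Tp x
        = ?a * (P * Z1 - Z * P1) * ((E_m (q * x) * D_minus b t x) * Z' * y - (E_p (q * x) * D_plus b t x) * P' * z)"
      unfolding b12 b11 wm tp by algebra
    also have "\<dots> = q * Quad t x * ((1 - b 2 * x) * (1 - b 3 * x) * Z' * y - (1 - b 1 * x) * (1 - b 4 * x) * P' * z)"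
      unfolding cas Ep Em by algebra
    finally show "\<beta> * poly Wm x + poly B11 (q * x) * poly Tp x = q * Quad t x * poly L x"
      unfolding L[OF x] defs .
  qed (intro continuous_intros)+

  have at_qt: "(\<lambda>x. \<beta> * poly Wp' x - poly B22 x * poly Tp' x) = (\<lambda>x. Quad (q * t) x * poly L x)"
  proof (rule eq_of_eq_off_countable[OF countable_bad])
    fix x assume x: "x \<notin> bad"
    note n = notin_bad[OF x]
    define P P1 Z Z1 P' Z' where "P = poly (p' ?n) x" and "P1 = poly (p' m) x"
      and "Z = B.Q ?n x" and "Z1 = B.Q m x" and "P' = poly (p' ?n) (q * x)" and "Z' = B.Q ?n (q * x)"
    define y z where "y = poly (p ?n) x" and "z = A.Q ?n x"
    note defs = P_def P1_def Z_def Z1_def P'_def Z'_def y_def z_def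
    let ?a' = "B.a ?n"
    have cas: "?a' * (P * Z1 - Z * P1) = 1"
      using B.casorati[OF B.notin_carrier(1)[OF n(2)], of ?n] B.a_nonzero by (simp add: defs)
    have b12: "\<beta> = E_m x * Z * y - E_p x * P * z"
      using B12[OF n(1,2)] by (simp add: \<beta> defs)
    have b22: "poly B22 x = E_m x * Z1 * y - E_p x * P1 * z"
      using B22[OF n(1,2)] by (simp add: defs)
    have wp: "poly Wp' x = ?a' * (D_plus b (q * t) x * P' * Z1 - D_minus b (q * t) x * Z' * P1)"
      unfolding eB(1)[OF n(2)] defs ..
    have tp: "poly Tp' x = ?a' * (D_plus b (q * t) x * P' * Z - D_minus b (q * t) x * Z' * P)"
      unfolding eB(2)[OF n(2)] defs ..
    have Ep: "E_p x * D_plus b (q * t) x = Quad (q * t) x * ((1 - b 1 * x) * (1 - b 4 * x))"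
      using A.b6 by (simp add: E_plus_def D_plus_def field_simps)
    have Em: "E_m x * D_minus b (q * t) x = Quad (q * t) x * ((1 - b 2 * x) * (1 - b 3 * x))"
      by (simp add: E_minus_def D_minus_def algebra_simps)
    have "\<beta> * poly Wp' x - poly B22 x * poly Tp' x
        = ?a' * (P * Z1 - Z * P1) * ((E_m x * D_minus b (q * t) x) * Z' * y - (E_p x * D_plus b (q * t) x) * P' * z)"
      unfolding b12 b22 wp tp by algebra
    also have "\<dots> = Quad (q * t) x * ((1 - b 2 * x) * (1 - b 3 * x) * Z' * y - (1 - b 1 * x) * (1 - b 4 * x) * P' * z)"
      unfolding cas Ep Em by algebra
    finally show "\<beta> * poly Wp' x - poly B22 x * poly Tp' x = Quad (q * t) x * poly L x"
      unfolding L[OF x] defs .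
  qed (intro continuous_intros)+

  have l0: "\<beta> = q * t * l0"
    using fun_cong[OF at_t, of 0] A.W_shape(6)[OF spec] A.Tp_shape(3)[OF spec] A.b6 A.s
    by (simp add: l)
  have "\<beta> \<noteq> 0"
  proof
    assume "\<beta> = 0"
    hence "l0 = 0" using l0 A.q_nz A.s by simp
    hence eq: "poly B11 (q * x) * poly Tp x = q * Quad t x * (x * l1)" for x
      using fun_cong[OF at_t, of x] by (simp add: \<open>\<beta> = 0\<close> l)
    have "l1 = 0" using eq[of g] Tp A.q_nz by simp
    hence "pcompose B11 [:0, q:] * Tp = 0"
      using eq by (intro poly_eq_off_countable[of "{}"]) (simp_all add: poly_scale)
    hence "pcompose B11 [:0, q:] = 0" using Tp by simp
    hence "B11 = 0" using A.q_nz by (subst (asm) pcompose_eq_0_iff) auto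
    thus False using B11_nz by simp
  qed
  have "\<beta> * (q * t * poly Wp' g') = q * t * Quad (q * t) g' * (l0 + g' * l1)"
    using fun_cong[OF at_qt, of g'] Tp' by (simp add: l)
  hence "Quad (q * t) g' * (\<beta> * (1 - f * g')) = Quad (q * t) g' * (q * t * (l0 + g' * l1))"
    unfolding Wp' by algebra
  hence "\<beta> * (1 - f * g') = q * t * (l0 + g' * l1)"
    using Tp'(3) by (simp only: mult_left_cancel simp_thms)
  hence "g' * (- (\<beta> * f)) = g' * (q * t * l1)" using l0 by algebra
  hence l1: "- (\<beta> * f) = q * t * l1"
    using Tp'(2) by (simp only: mult_left_cancel simp_thms)
  have "\<beta> * poly Wm g = q * Quad t g * (l0 + g * l1)"
    using fun_cong[OF at_t, of g] Tp by (simp add: l)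
  hence "\<beta> * (t * poly Wm g) = \<beta> * (Quad t g * (1 - f * g))"
    using l0 l1 by algebra
  thus ?thesis using \<open>\<beta> \<noteq> 0\<close> by (simp only: mult_left_cancel simp_thms)
qed

end

section \<open>Coefficients of the diagonal entries\<close>

context
  fixes b5 b6 t f g e1 e3 r w1 w2 v1 v2 :: complex
  assumes nz: "b5 \<noteq> 0" "b6 \<noteq> 0" "t \<noteq> 0" "f \<noteq> 0" "g \<noteq> 0" "1 - b5\<^sup>2 \<noteq> 0"
    and lin1: "w1 + v1 = - (1 + b6\<^sup>2) - e1 * b6 * t"
    and lin5: "b5 * v2 + w2 / b5 = t * (1 + b6\<^sup>2) + e3 * b6"
    and Wp_g: "- b5 * b6 * g ^ 3 + w2 * g\<^sup>2 + w1 * g + b6 * t = b6 * t * r"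
    and Wm_g: "t * (- (b6 / b5) * g ^ 3 + v2 * g\<^sup>2 + v1 * g + b6 * t)
      = (t - b6 * g) * (b6 * t - g) * (1 - f * g)"
begin

lemma sum_quadratic:
  "w2 + v2 = b6 * t * (r - 1 + (e1 - f) * g) / g\<^sup>2 + b6 / t + (1 + b6\<^sup>2) * f - b6 * f * g / t
     + b6 * (b5 + 1 / b5) * g"
proof -
  have "t * (- (b6 / b5) * g ^ 3 + v2 * g\<^sup>2 + v1 * g + b6 * t) + t * (- b5 * b6 * g ^ 3 + w2 * g\<^sup>2 + w1 * g + b6 * t)
    = (t - b6 * g) * (b6 * t - g) * (1 - f * g) + t * (b6 * t * r)"
    by (simp only: Wp_g Wm_g)
  moreover have "v1 = - (1 + b6\<^sup>2) - e1 * b6 * t - w1" using lin1 by algebra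
  ultimately have "t * g\<^sup>2 * (w2 + v2) = (t - b6 * g) * (b6 * t - g) * (1 - f * g) + t * (b6 * t * r)
      + t * (b6 / b5 + b5 * b6) * g ^ 3 - 2 * b6 * t\<^sup>2 + t * g * ((1 + b6\<^sup>2) + e1 * b6 * t)"
    by algebra
  also have "\<dots> = t * g\<^sup>2 * (b6 * t * (r - 1 + (e1 - f) * g) / g\<^sup>2 + b6 / t + (1 + b6\<^sup>2) * f - b6 * f * g / t
     + b6 * (b5 + 1 / b5) * g)"
    using nz by (simp add: divide_simps) algebra
  finally show ?thesis using nz by simp
qed

lemma v2_eq: "v2 = ((w2 + v2) - b5 * (t * (1 + b6\<^sup>2) + e3 * b6)) / (1 - b5\<^sup>2)"
proof -
  have "b5\<^sup>2 * v2 + w2 = b5 * (t * (1 + b6\<^sup>2) + e3 * b6)"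
    using lin5 nz by (simp add: field_simps power2_eq_square)
  hence "v2 * (1 - b5\<^sup>2) = (w2 + v2) - b5 * (t * (1 + b6\<^sup>2) + e3 * b6)" by algebra
  thus ?thesis using nz by (simp add: eq_divide_eq)
qed

lemma w2_eq: "w2 = b5 * (t * (1 + b6\<^sup>2) + e3 * b6 - b5 * (w2 + v2)) / (1 - b5\<^sup>2)"
proof -
  have "b5\<^sup>2 * v2 + w2 = b5 * (t * (1 + b6\<^sup>2) + e3 * b6)"
    using lin5 nz by (simp add: field_simps power2_eq_square)
  hence "w2 * (1 - b5\<^sup>2) = b5 * (t * (1 + b6\<^sup>2) + e3 * b6 - b5 * (w2 + v2))" by algebra
  thus ?thesis using nz by (simp add: eq_divide_eq)
qed

lemma expand_B:
  "b6 * (b5 * f - t) / t * (g * (t - f * b5) / f + t * b5 * (1 + b6\<^sup>2) / b6)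
      = - b6 * g * b5\<^sup>2 * f / t + 2 * b6 * g * b5 - b6 * g * t / f + (b5 * f - t) * b5 * (1 + b6\<^sup>2)"
  using nz by (simp add: field_simps power2_eq_square)

lemma expand_X:
  "((t\<^sup>2 - g\<^sup>2 * b5\<^sup>2) * (b5 + t * g) - e1 * t\<^sup>2 * g * b5 + e3 * t * g\<^sup>2 * b5\<^sup>2) / (b5 * g\<^sup>2)
      = t\<^sup>2 / g\<^sup>2 - b5\<^sup>2 + t ^ 3 / (b5 * g) - g * b5 * t - e1 * t\<^sup>2 / g + e3 * t * b5"
  using nz by (simp add: field_simps power2_eq_square power3_eq_cube)

lemma expand_Z:
  "b6 * (b5 * f - t) / b5 * (- t\<^sup>2 / g - g * b5\<^sup>2 + b5\<^sup>2 * (1 + b6\<^sup>2) * t / b6)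
      = - b6 * f * t\<^sup>2 / g + b6 * t ^ 3 / (b5 * g) - b6 * f * g * b5\<^sup>2 + b6 * t * g * b5
        + (b5 * f - t) * b5 * (1 + b6\<^sup>2) * t"
  using nz by (simp add: field_simps power2_eq_square power3_eq_cube)

lemma expand_Y:
  "b6 * (b5 * f - t) / b5
     * (b5\<^sup>2 * (1 + b6\<^sup>2) * t / b6 + b5 * g / f * (t - b5 * f) + b5 / f\<^sup>2 * (t + b5 * f - t * f * e3))
   = (b5 * f - t) * b5 * (1 + b6\<^sup>2) * t
     + b6 * (2 * b5 * g * t - b5\<^sup>2 * f * g + b5\<^sup>2 - b5 * e3 * t - t\<^sup>2 * g / f - t\<^sup>2 / f\<^sup>2 + t\<^sup>2 * e3 / f)"
  using nz by (simp add: field_simps power2_eq_square power3_eq_cube)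

lemma w2_r:
  "w2 - b5 * b6 * g = b6 / (1 - b5\<^sup>2) * (- b5\<^sup>2 / t + b5 * e3)
     - b6 * (b5 * f - t) / ((1 - b5\<^sup>2) * t) * (g * (t - f * b5) / f + t * b5 * (1 + b6\<^sup>2) / b6)
     + b6 * t / (1 - b5\<^sup>2) * (b5\<^sup>2 / g\<^sup>2 - e1 * (b5\<^sup>2 / g) + b5\<^sup>2 * (f / g) - g / f - b5\<^sup>2 * r / g\<^sup>2)"
proof -
  define k where "k = 1 / (1 - b5\<^sup>2)"
  have M: "b5 * (w2 + v2) = b6 * t * b5 * (r - 1) / g\<^sup>2 + b6 * t * b5 * (e1 - f) / g + b5 * b6 / t
      + b5 * (1 + b6\<^sup>2) * f - b5 * b6 * f * g / t + b6 * (b5\<^sup>2 + 1) * g"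
    unfolding sum_quadratic using nz by (simp add: field_simps power2_eq_square)
  have "w2 - b5 * b6 * g = k * (b5 * (t * (1 + b6\<^sup>2) + e3 * b6 - b5 * (w2 + v2)) - (1 - b5\<^sup>2) * (b5 * b6 * g))"
    by (subst w2_eq) (use nz in \<open>simp add: k_def diff_divide_distrib\<close>)
  also have "\<dots> = k * b6 * (- b5\<^sup>2 / t + b5 * e3)
     - k * (b6 * (b5 * f - t) / t * (g * (t - f * b5) / f + t * b5 * (1 + b6\<^sup>2) / b6))
     + k * b6 * t * (b5\<^sup>2 / g\<^sup>2 - e1 * (b5\<^sup>2 / g) + b5\<^sup>2 * (f / g) - g / f - b5\<^sup>2 * r / g\<^sup>2)"
    unfolding M expand_B by (simp only: divide_inverse) algebra
  finally show ?thesis by (simp add: k_def mult.assoc)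
qed

lemma v2_r:
  "t * v2 - b6 - f * t * (1 + b6\<^sup>2) + b6 * (b5 * f - t) / b5 * g
    = b6 * t\<^sup>2 / (1 - b5\<^sup>2) * (r / g\<^sup>2)
      - b6 / (1 - b5\<^sup>2) * (((t\<^sup>2 - g\<^sup>2 * b5\<^sup>2) * (b5 + t * g) - e1 * t\<^sup>2 * g * b5 + e3 * t * g\<^sup>2 * b5\<^sup>2) / (b5 * g\<^sup>2))
      + b6 * (b5 * f - t) / (b5 * (1 - b5\<^sup>2)) * (- t\<^sup>2 / g - g * b5\<^sup>2 + b5\<^sup>2 * (1 + b6\<^sup>2) * t / b6)"
proof -
  define k where "k = 1 / (1 - b5\<^sup>2)"
  have k: "k * (1 - b5\<^sup>2) = 1" using nz by (simp add: k_def)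
  have M: "t * (w2 + v2) = b6 * t\<^sup>2 * (r - 1) / g\<^sup>2 + b6 * t\<^sup>2 * (e1 - f) / g + b6
      + t * (1 + b6\<^sup>2) * f - b6 * f * g + b6 * t * (b5 + 1 / b5) * g"
    unfolding sum_quadratic using nz by (simp add: field_simps power2_eq_square)
  have \<alpha>: "b6 * (b5 * f - t) / b5 * g = b6 * f * g - b6 * t * (1 / b5) * g"
    using nz by (simp add: field_simps)
  have b: "(1 / b5) * b5 = 1" using nz by simp
  have "t * v2 = k * (t * (w2 + v2) - t * b5 * (t * (1 + b6\<^sup>2) + e3 * b6))"
    by (subst v2_eq) (simp add: k_def right_diff_distrib diff_divide_distrib)
  also have "t * (w2 + v2) - t * b5 * (t * (1 + b6\<^sup>2) + e3 * b6) = b6 * t\<^sup>2 * (r / g\<^sup>2)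
      - b6 * (t\<^sup>2 / g\<^sup>2 - b5\<^sup>2 + t ^ 3 / (b5 * g) - g * b5 * t - e1 * t\<^sup>2 / g + e3 * t * b5)
      + (- b6 * f * t\<^sup>2 / g + b6 * t ^ 3 / (b5 * g) - b6 * f * g * b5\<^sup>2 + b6 * t * g * b5
        + (b5 * f - t) * b5 * (1 + b6\<^sup>2) * t)
      + (1 - b5\<^sup>2) * (b6 + f * t * (1 + b6\<^sup>2) - (b6 * f * g - b6 * t * (1 / b5) * g))"
    unfolding M using b by (simp only: divide_inverse) algebra
  finally have "t * v2 - b6 - f * t * (1 + b6\<^sup>2) + b6 * (b5 * f - t) / b5 * g = k * b6 * t\<^sup>2 * (r / g\<^sup>2)
      - k * b6 * (t\<^sup>2 / g\<^sup>2 - b5\<^sup>2 + t ^ 3 / (b5 * g) - g * b5 * t - e1 * t\<^sup>2 / g + e3 * t * b5)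
      + k * (- b6 * f * t\<^sup>2 / g + b6 * t ^ 3 / (b5 * g) - b6 * f * g * b5\<^sup>2 + b6 * t * g * b5
        + (b5 * f - t) * b5 * (1 + b6\<^sup>2) * t)"
    using k unfolding \<alpha> by (simp only: distrib_left[of k] right_diff_distrib[of k]) algebra
  thus ?thesis
    unfolding expand_X[symmetric] expand_Z[symmetric] by (simp add: k_def mult.assoc)
qed

lemma Wp_decomp:
  assumes "x \<noteq> 0" "x \<noteq> g"
  shows "(- b5 * b6 * x ^ 3 + w2 * x\<^sup>2 + w1 * x + b6 * t) / (x * (x - g))
    = - b5 * b6 * x + (w2 - b5 * b6 * g) - b6 * t / (x * g) + b6 * t * r / (g * (x - g))"
proof -
  have "(- b5 * b6 * x ^ 3 + w2 * x\<^sup>2 + w1 * x + b6 * t) * g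
    = g * x * (x - g) * (- b5 * b6 * x + (w2 - b5 * b6 * g)) - b6 * t * (x - g) + b6 * t * r * x"
    unfolding Wp_g[symmetric] by algebra
  hence 1: "- b5 * b6 * x ^ 3 + w2 * x\<^sup>2 + w1 * x + b6 * t
    = (g * x * (x - g) * (- b5 * b6 * x + (w2 - b5 * b6 * g)) - b6 * t * (x - g) + b6 * t * r * x) / g"
    by (rule eq_divide_imp[OF nz(5)])
  have 2: "(g * x * d * A - B * d + C * x) / g / (x * d) = A - B / (x * g) + C / (g * d)"
    if "d \<noteq> 0" for d A B C
    using that assms(1) nz(5) by (simp add: field_simps)
  show ?thesis
    unfolding 1 by (rule 2) (use assms in simp)
qed

lemma Wm_decomp:
  assumes "x \<noteq> 0" "x \<noteq> g"
  shows "t * (- (b6 / b5) * x ^ 3 + v2 * x\<^sup>2 + v1 * x + b6 * t) / (x * (x - g))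
    = (1 - x * f) * (x - b6 * t) * (x * b6 - t) / (x * (x - g)) + b6 * (b5 * f - t) / b5 * x
      + (t * v2 - b6 - f * t * (1 + b6\<^sup>2) + b6 * (b5 * f - t) / b5 * g)"
proof -
  define u where "u = 1 / b5"
  define D where "D y = t * (- (b6 * u) * y ^ 3 + v2 * y\<^sup>2 + v1 * y + b6 * t) - (1 - y * f) * (y - b6 * t) * (y * b6 - t)" for y
  let ?\<alpha> = "b6 * (f - t * u)"
  have u: "b6 / b5 = b6 * u" "b6 * (b5 * f - t) / b5 = ?\<alpha>"
    using nz by (simp_all add: u_def field_simps)
  have "D g = 0" using Wm_g unfolding D_def u by algebra
  moreover have "g * D x = g * (x * (x - g) * (?\<alpha> * x + (t * v2 - b6 - f * t * (1 + b6\<^sup>2) + ?\<alpha> * g))) + x * D g"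
    unfolding D_def by algebra
  ultimately have "D x = x * (x - g) * (?\<alpha> * x + (t * v2 - b6 - f * t * (1 + b6\<^sup>2) + ?\<alpha> * g))"
    using nz by simp
  hence "t * (- (b6 * u) * x ^ 3 + v2 * x\<^sup>2 + v1 * x + b6 * t) = (1 - x * f) * (x - b6 * t) * (x * b6 - t)
     + x * (x - g) * (?\<alpha> * x + (t * v2 - b6 - f * t * (1 + b6\<^sup>2) + ?\<alpha> * g))"
    unfolding D_def by algebra
  thus ?thesis
    unfolding u using assms by (simp add: add_divide_distrib)
qed

lemma formula_Wm_g:
  assumes "x \<noteq> 0" "x \<noteq> g" and d: "t * g - b5 \<noteq> 0"
    and E: "r * (1 - f * g) = E"
    and J: "g\<^sup>2 * J = b5\<^sup>2 * t\<^sup>2 * E + (t * g - b5)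
      * ((t\<^sup>2 - g\<^sup>2 * b5\<^sup>2) * (b5 + t * g) - e1 * t\<^sup>2 * g * b5 + e3 * t * g\<^sup>2 * b5\<^sup>2)"
  shows "t * (- (b6 / b5) * x ^ 3 + v2 * x\<^sup>2 + v1 * x + b6 * t) / (x * (x - g)) =
           (1 - x * f) * (x - b6 * t) * (x * b6 - t) / (x * (x - g))
           - b6 / (1 - b5\<^sup>2) * (J / (b5 * (t * g - b5)))
           + b6 * (b5 * f - t) / (b5 * (1 - b5\<^sup>2))
               * ((1 - b5\<^sup>2) * x - t\<^sup>2 / g - g * b5\<^sup>2
                  + b5\<^sup>2 * (1 + b6\<^sup>2) * t / b6
                  - b5 * t\<^sup>2 * r / (g * (t * g - b5)))"
proof -
  define X where "X = (t\<^sup>2 - g\<^sup>2 * b5\<^sup>2) * (b5 + t * g) - e1 * t\<^sup>2 * g * b5 + e3 * t * g\<^sup>2 * b5\<^sup>2"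
  define k d where "k = 1 / (1 - b5\<^sup>2)" and "d = t * g - b5"
  have k: "k * (1 - b5\<^sup>2) = 1" and d0: "d \<noteq> 0" using nz assms by (simp_all add: k_def d_def)
  have "g\<^sup>2 * J = b5\<^sup>2 * t\<^sup>2 * r * (1 - f * g) + d * X"
    using J E unfolding X_def d_def by algebra
  hence "g\<^sup>2 * J + (b5 * f - t) * b5 * t\<^sup>2 * r * g = d * (X - b5 * t\<^sup>2 * r)"
    unfolding d_def by algebra
  hence "(g\<^sup>2 * J + (b5 * f - t) * b5 * t\<^sup>2 * r * g) / (b5 * d * g\<^sup>2) = d * (X - b5 * t\<^sup>2 * r) / (b5 * d * g\<^sup>2)"
    by simp
  hence J': "J / (b5 * d) + (b5 * f - t) / b5 * (b5 * t\<^sup>2 * r / (g * d)) = X / (b5 * g\<^sup>2) - t\<^sup>2 * (r / g\<^sup>2)"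
    using nz d0 by (simp add: add_divide_distrib diff_divide_distrib power2_eq_square ring_distribs mult_ac)
  define j \<rho> x' r' where "j = J / (b5 * d)" and "\<rho> = b5 * t\<^sup>2 * r / (g * d)" and "x' = X / (b5 * g\<^sup>2)" and "r' = r / g\<^sup>2"
  have J'': "j + (b5 * f - t) / b5 * \<rho> = x' - t\<^sup>2 * r'"
    using J' by (simp add: j_def \<rho>_def x'_def r'_def)
  have div: "b6 * (b5 * f - t) / (b5 * (1 - b5\<^sup>2)) = b6 * k * ((b5 * f - t) / b5)"
    "b6 * t\<^sup>2 / (1 - b5\<^sup>2) = b6 * k * t\<^sup>2" "b6 / (1 - b5\<^sup>2) = b6 * k"
    "b6 * (b5 * f - t) / b5 = b6 * ((b5 * f - t) / b5)"
    by (simp_all add: k_def)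
  show ?thesis
    unfolding Wm_decomp[OF assms(1,2)] v2_r
    unfolding X_def[symmetric] d_def[symmetric] j_def[symmetric] \<rho>_def[symmetric] x'_def[symmetric] r'_def[symmetric] div
    using k J'' by algebra
qed

lemma formula_Wp_g:
  assumes "x \<noteq> 0" "x \<noteq> g"
  shows "(- b5 * b6 * x ^ 3 + w2 * x\<^sup>2 + w1 * x + b6 * t) / (x * (x - g)) =
           - x * b5 * b6
           + b6 / (1 - b5\<^sup>2) * (- b5\<^sup>2 / t + b5 * e3)
           - b6 * (b5 * f - t) / ((1 - b5\<^sup>2) * t)
               * (g * (t - f * b5) / f + t * b5 * (1 + b6\<^sup>2) / b6)
           + b6 * t / (1 - b5\<^sup>2)
               * (b5\<^sup>2 / g\<^sup>2 - (1 - b5\<^sup>2) / (x * g) - e1 * (b5\<^sup>2 / g)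
                  + b5\<^sup>2 * (f / g) - g / f + (g - x * b5\<^sup>2) * r / (g\<^sup>2 * (x - g)))"
proof -
  have 1: "b6 * t * r / (g * (x - g)) = b6 * t / (1 - b5\<^sup>2) * ((g - x * b5\<^sup>2) * r / (g\<^sup>2 * (x - g)) + b5\<^sup>2 * r / g\<^sup>2)"
    using assms nz by (simp add: divide_simps) algebra
  have 2: "b6 * t / (x * g) = b6 * t / (1 - b5\<^sup>2) * ((1 - b5\<^sup>2) / (x * g))"
    using nz by simp
  have "- b5 * b6 * x + (A - B + k * (c1 - c2 + c3 - c4 - c5)) - k * d + k * (e + c5)
      = - x * b5 * b6 + A - B + k * (c1 - d - c2 + c3 - c4 + e)" for A B k c1 c2 c3 c4 c5 d e :: complex
    by algebra
  thus ?thesis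
    unfolding Wp_decomp[OF assms] w2_r 1 2 .
qed

context
  fixes \<eta> :: complex
  assumes \<eta>: "f\<^sup>2 * r = g\<^sup>2 * \<eta> + (f\<^sup>2 - g\<^sup>2) * (1 + f * g) - e1 * f\<^sup>2 * g + e3 * f * g\<^sup>2"
begin

lemma r_eta: "r / g\<^sup>2 = \<eta> / f\<^sup>2 + 1 / g\<^sup>2 - 1 / f\<^sup>2 + f / g - g / f - e1 / g + e3 / f"
proof -
  have "r = (g\<^sup>2 * \<eta> + (f\<^sup>2 - g\<^sup>2) * (1 + f * g) - e1 * f\<^sup>2 * g + e3 * f * g\<^sup>2) / f\<^sup>2"
    using \<eta> nz by (simp add: eq_divide_eq mult.commute)
  thus ?thesis
    by (rule ssubst) (use nz in \<open>simp add: field_simps power2_eq_square\<close>)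
qed

lemma w2_eta:
  "w2 - b5 * b6 * g = - (b6 * t / (1 - b5\<^sup>2)) * (b5\<^sup>2 * \<eta> / f\<^sup>2) - b6 * t * (1 / f) * (1 / f + g - e3)
    - b6 * (b5 * f - t) / (b5 * (1 - b5\<^sup>2) * t)
       * (b5\<^sup>2 * (1 + b6\<^sup>2) * t / b6 + b5 * g / f * (t - b5 * f) + b5 / f\<^sup>2 * (t + b5 * f - t * f * e3))"
proof -
  define k u where "k = 1 / (1 - b5\<^sup>2)" and "u = 1 / t"
  have k: "k * (1 - b5\<^sup>2) = 1" and u: "u * t = 1" using nz by (simp_all add: k_def u_def)
  have "w2 - b5 * b6 * g = k * b6 * (- b5\<^sup>2 * u + b5 * e3)
     - k * (b6 * (b5 * f - t) / t * (g * (t - f * b5) / f + t * b5 * (1 + b6\<^sup>2) / b6))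
     + k * b6 * t * (b5\<^sup>2 * (1 / g\<^sup>2) - e1 * (b5\<^sup>2 / g) + b5\<^sup>2 * (f / g) - g / f - b5\<^sup>2 * (r / g\<^sup>2))"
    unfolding w2_r by (simp add: k_def u_def mult.assoc)
  also have "\<dots> = - (k * b6 * t) * (b5\<^sup>2 * (\<eta> / f\<^sup>2)) - b6 * t * (1 / f\<^sup>2 + g / f - e3 / f)
    - k * u * (b6 * (b5 * f - t) / b5
       * (b5\<^sup>2 * (1 + b6\<^sup>2) * t / b6 + b5 * g / f * (t - b5 * f) + b5 / f\<^sup>2 * (t + b5 * f - t * f * e3)))"
    unfolding expand_B expand_Y r_eta using k u[unfolded u_def]
    by (simp only: u_def divide_inverse mult_1_left) algebra
  also have "1 / f\<^sup>2 + g / f - e3 / f = (1 / f) * (1 / f + g - e3)"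
    using nz by (simp add: field_simps power2_eq_square)
  finally show ?thesis by (simp add: k_def u_def mult.assoc)
qed

lemma v2_eta:
  "t * v2 - b6 - f * t * (1 + b6\<^sup>2) + b6 * (b5 * f - t) / b5 * g
    = b6 * t\<^sup>2 / (1 - b5\<^sup>2) * (\<eta> / f\<^sup>2)
      + b6 * (b5 * f - t) / (b5 * (1 - b5\<^sup>2))
       * (b5\<^sup>2 * (1 + b6\<^sup>2) * t / b6 + b5 * g / f * (t - b5 * f) + b5 / f\<^sup>2 * (t + b5 * f - t * f * e3))"
proof -
  define k where "k = 1 / (1 - b5\<^sup>2)"
  have "t * v2 - b6 - f * t * (1 + b6\<^sup>2) + b6 * (b5 * f - t) / b5 * g = k * (b6 * t\<^sup>2 * (r / g\<^sup>2)
      - b6 * (((t\<^sup>2 - g\<^sup>2 * b5\<^sup>2) * (b5 + t * g) - e1 * t\<^sup>2 * g * b5 + e3 * t * g\<^sup>2 * b5\<^sup>2) / (b5 * g\<^sup>2))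
      + b6 * (b5 * f - t) / b5 * (- t\<^sup>2 / g - g * b5\<^sup>2 + b5\<^sup>2 * (1 + b6\<^sup>2) * t / b6))"
    unfolding v2_r by (simp add: k_def diff_divide_distrib add_divide_distrib)
  also have "\<dots> = k * (b6 * t\<^sup>2 * (\<eta> / f\<^sup>2) + b6 * (b5 * f - t) / b5
       * (b5\<^sup>2 * (1 + b6\<^sup>2) * t / b6 + b5 * g / f * (t - b5 * f) + b5 / f\<^sup>2 * (t + b5 * f - t * f * e3)))"
    unfolding expand_X expand_Z expand_Y r_eta by (simp only: divide_inverse mult_1_left) algebra
  finally show ?thesis by (simp add: k_def add_divide_distrib)
qed

lemma formula_Wm_f:
  assumes "x \<noteq> 0" "x \<noteq> g"
  shows "t * (- (b6 / b5) * x ^ 3 + v2 * x\<^sup>2 + v1 * x + b6 * t) / (x * (x - g)) =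
           (1 - x * f) * (x - b6 * t) * (b6 * x - t) / (x * (x - g))
           + b6 * t\<^sup>2 / (1 - b5\<^sup>2) * (\<eta> / f\<^sup>2)
           + b6 * (b5 * f - t) / (b5 * (1 - b5\<^sup>2))
               * ((1 - b5\<^sup>2) * x + b5\<^sup>2 * (1 + b6\<^sup>2) * t / b6 + b5 * g / f * (t - b5 * f)
                  + b5 / f\<^sup>2 * (t + b5 * f - t * f * e3))"
proof -
  have "b6 * (b5 * f - t) / b5 * x = b6 * (b5 * f - t) / (b5 * (1 - b5\<^sup>2)) * ((1 - b5\<^sup>2) * x)"
    using nz by simp
  thus ?thesis
    unfolding Wm_decomp[OF assms] v2_eta by (simp only: distrib_left mult.commute[of b6 x] add_ac)
qed

lemma partial_fractions:
  assumes "x \<noteq> 0" "x \<noteq> g" "1 - x * f \<noteq> 0"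
    and e: "r * (1 - f * g) = 1 - e1 * g + e2 * g\<^sup>2 - e3 * g ^ 3 + g ^ 4"
  shows "(1 - e1 * x + e2 * x\<^sup>2 - e3 * x ^ 3 + x ^ 4) / (x * (1 - x * f) * (x - g))
    = - x / f - (1 / f) * (1 / f + g - e3) - 1 / (x * g) + r / (g * (x - g)) + \<eta> / (f\<^sup>2 * (1 - x * f))"
proof -
  have 1: "f\<^sup>2 * g\<^sup>2 * (1 - e1 * x + e2 * x\<^sup>2 - e3 * x ^ 3 + x ^ 4)
    = - (x * (1 - x * f) * (x - g) * g\<^sup>2 * (x * f + 1 + f * g - e3 * f)) - f\<^sup>2 * g * (1 - x * f) * (x - g)
      + f\<^sup>2 * g * x * (1 - x * f) * r + x * (x - g) * (g\<^sup>2 * \<eta>)"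
  proof -
    have "g\<^sup>2 * \<eta> = f\<^sup>2 * r - ((f\<^sup>2 - g\<^sup>2) * (1 + f * g) - e1 * f\<^sup>2 * g + e3 * f * g\<^sup>2)"
      using \<eta> by algebra
    moreover have "e2 * g\<^sup>2 = r * (1 - f * g) - 1 + e1 * g + e3 * g ^ 3 - g ^ 4" using e by algebra
    ultimately show ?thesis by algebra
  qed
  have "(f\<^sup>2 * g\<^sup>2) * (- x / f - (1 / f) * (1 / f + g - e3) - 1 / (x * g) + r / (g * D) + \<eta> / (f\<^sup>2 * F)) * (x * F * D)
    = - (x * F * D * g\<^sup>2 * (x * f + 1 + f * g - e3 * f)) - f\<^sup>2 * g * F * D
      + f\<^sup>2 * g * x * F * r + x * D * (g\<^sup>2 * \<eta>)" if "D \<noteq> 0" "F \<noteq> 0" for D F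
    using that assms(1) nz by (simp add: field_simps power2_eq_square)
  from this[of "x - g" "1 - x * f"]
  have "(f\<^sup>2 * g\<^sup>2) * ((- x / f - (1 / f) * (1 / f + g - e3) - 1 / (x * g) + r / (g * (x - g)) + \<eta> / (f\<^sup>2 * (1 - x * f))) * (x * (1 - x * f) * (x - g)))
    = (f\<^sup>2 * g\<^sup>2) * (1 - e1 * x + e2 * x\<^sup>2 - e3 * x ^ 3 + x ^ 4)"
    unfolding 1 using assms by (simp add: mult.assoc)
  hence "(- x / f - (1 / f) * (1 / f + g - e3) - 1 / (x * g) + r / (g * (x - g)) + \<eta> / (f\<^sup>2 * (1 - x * f))) * (x * (1 - x * f) * (x - g))
    = 1 - e1 * x + e2 * x\<^sup>2 - e3 * x ^ 3 + x ^ 4"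
    by (rule mult_left_cancel[THEN iffD1, rotated]) (use nz in simp)
  thus ?thesis
    by (intro eq_divide_imp[symmetric]) (use assms in simp_all)
qed

lemma formula_Wp_f:
  assumes "x \<noteq> 0" "x \<noteq> g" "1 - f * x \<noteq> 0"
    and e: "r * (1 - f * g) = 1 - e1 * g + e2 * g\<^sup>2 - e3 * g ^ 3 + g ^ 4"
  shows "(- b5 * b6 * x ^ 3 + w2 * x\<^sup>2 + w1 * x + b6 * t) / (x * (x - g)) =
           - (b6 * t / (1 - b5\<^sup>2)) * ((1 - b5\<^sup>2 * f * x) * \<eta> / (f\<^sup>2 * (1 - f * x)))
           + b6 * t * (1 - e1 * x + e2 * x\<^sup>2 - e3 * x ^ 3 + x ^ 4) / (x * (1 - x * f) * (x - g))
           - b6 * (b5 * f - t) / f * x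
           - b6 * (b5 * f - t) / (b5 * (1 - b5\<^sup>2) * t)
               * (b5\<^sup>2 * (1 + b6\<^sup>2) * t / b6 + b5 * g / f * (t - b5 * f) + b5 / f\<^sup>2 * (t + b5 * f - t * f * e3))"
proof -
  have F: "1 - x * f \<noteq> 0" "1 - f * x = 1 - x * f" using assms by (simp_all add: mult.commute)
  have 1: "b6 * t * (1 - e1 * x + e2 * x\<^sup>2 - e3 * x ^ 3 + x ^ 4) / (x * (1 - x * f) * (x - g))
    = b6 * t * (- x / f - (1 / f) * (1 / f + g - e3) - 1 / (x * g) + r / (g * (x - g)) + \<eta> / (f\<^sup>2 * (1 - x * f)))"
    unfolding partial_fractions[OF assms(1,2) F(1) e, symmetric] by simp
  have "(1 - b5\<^sup>2 * f * x) / (1 - x * f) = (1 - b5\<^sup>2) / (1 - x * f) + b5\<^sup>2"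
    using F by (simp add: divide_simps) algebra
  hence "(1 - b5\<^sup>2 * f * x) / (1 - x * f) * (\<eta> / f\<^sup>2) = (1 - b5\<^sup>2) * (\<eta> / (f\<^sup>2 * (1 - x * f))) + b5\<^sup>2 * \<eta> / f\<^sup>2"
    by (simp only: distrib_right) (simp add: mult.commute)
  hence 2: "(1 - b5\<^sup>2 * f * x) * \<eta> / (f\<^sup>2 * (1 - x * f)) = (1 - b5\<^sup>2) * (\<eta> / (f\<^sup>2 * (1 - x * f))) + b5\<^sup>2 * \<eta> / f\<^sup>2"
    by (simp add: mult.commute)
  have 3: "b6 * (b5 * f - t) / f * x = b6 * b5 * x - b6 * t * (x / f)"
    using nz by (simp add: field_simps)
  have 4: "b6 * t / (x * g) = b6 * t * (1 / (x * g))" "b6 * t * r / (g * (x - g)) = b6 * t * (r / (g * (x - g)))"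
    "- x / f = - (x / f)" by simp_all
  have gen: "- b5 * b6 * x + (- k * h - b6 * t * c * c' - Y) - b6 * t * m + b6 * t * r'
    = - k * (K * h' + h) + b6 * t * (- \<xi> - c * c' - m + r' + h') - (b6 * b5 * x - b6 * t * \<xi>) - Y"
    if "k * K = b6 * t" for k K h h' c c' m r' Y \<xi> :: complex
    using that by algebra
  show ?thesis
    unfolding Wp_decomp[OF assms(1,2)] w2_eta F(2) 1 2 3 4
    by (rule gen) (use nz in simp)
qed

end

end

lemma root_form:
  fixes P :: "complex poly"
  assumes "degree P \<le> 2" "poly P 0 = 0" "poly (P div [:0, 1:]) g = 0"
  shows "P = smult (coeff P 2) ([:0, 1:] * [:- g, 1:])"
proof -
  have P: "P = [:0, 1:] * [:coeff P 1, coeff P 2:]"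
  proof (rule poly_eqI)
    fix k show "coeff P k = coeff ([:0, 1:] * [:coeff P 1, coeff P 2:]) k"
      using assms(1,2) by (cases "k \<le> 2")
        (auto simp: le_Suc_eq numeral_2_eq_2 poly_0_coeff_0 coeff_eq_0 coeff_pCons split: nat.splits)
  qed
  have "P div [:0, 1:] = [:coeff P 1, coeff P 2:]"
    by (subst P) (rule nonzero_mult_div_cancel_left, simp)
  hence "coeff P 1 = - (coeff P 2 * g)"
    using assms(3) by (simp add: eq_neg_iff_add_eq_0 mult.commute)
  thus ?thesis by (subst P) simp
qed

lemma cubic_form:
  fixes P :: "complex poly"
  assumes "degree P \<le> 3"
  shows "poly P x = coeff P 3 * x ^ 3 + coeff P 2 * x\<^sup>2 + coeff P 1 * x + poly P 0"
proof -
  have "P = [:coeff P 0, coeff P 1, coeff P 2, coeff P 3:]"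
  proof (rule poly_eqI)
    fix k show "coeff P k = coeff [:coeff P 0, coeff P 1, coeff P 2, coeff P 3:] k"
      using assms by (cases "k \<le> 3")
        (auto simp: le_Suc_eq numeral_2_eq_2 numeral_3_eq_3 coeff_eq_0 coeff_pCons split: nat.splits)
  qed
  hence "poly P x = poly [:coeff P 0, coeff P 1, coeff P 2, coeff P 3:] x" by simp
  thus ?thesis by (simp add: poly_0_coeff_0 power2_eq_square power3_eq_cube algebra_simps)
qed

lemma det_coefficients:
  fixes c0 c3 d3 w1 w2 v1 v2 :: complex
  assumes "\<And>x. (c3 * x ^ 3 + w2 * x\<^sup>2 + w1 * x + c0) * (d3 * x ^ 3 + v2 * x\<^sup>2 + v1 * x + c0)
      + k * (x * (x - g)) * (x * (x - g'))
    = (1 - e1 * x + e2 * x\<^sup>2 - e3 * x ^ 3 + x ^ 4) * (a0 + a1 * x + a2 * x\<^sup>2)"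
  shows "c0 * (w1 + v1) = a1 - e1 * a0" "c3 * v2 + d3 * w2 = a1 - e3 * a2"
proof -
  have "[:c0, w1, w2, c3:] * [:c0, v1, v2, d3:] + smult k ([:0, 1:] * [:- g, 1:] * ([:0, 1:] * [:- g', 1:]))
    = [:1, - e1, e2, - e3, 1:] * [:a0, a1, a2:]" (is "?L = ?R")
  proof (rule poly_eq_off_countable[of "{}"])
    fix x
    have "poly ?L x = (c3 * x ^ 3 + w2 * x\<^sup>2 + w1 * x + c0) * (d3 * x ^ 3 + v2 * x\<^sup>2 + v1 * x + c0)
      + k * (x * (x - g)) * (x * (x - g'))" unfolding poly_add poly_mult poly_smult poly_pCons poly_0 by algebra
    also have "\<dots> = poly ?R x" unfolding assms poly_mult poly_pCons poly_0 by algebra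
    finally show "poly ?L x = poly ?R x" .
  qed simp
  hence "coeff ?L 1 = coeff ?R 1" "coeff ?L 5 = coeff ?R 5" by simp_all
  thus "c0 * (w1 + v1) = a1 - e1 * a0" "c3 * v2 + d3 * w2 = a1 - e3 * a2"
    by (simp_all add: eval_nat_numeral algebra_simps)
qed

lemma prod_1_4: "(\<Prod>j=1..4::nat. F j) = F 1 * F 2 * F 3 * (F 4 :: complex)"
proof -
  have "{1..4::nat} = {1, 2, 3, 4}" by auto
  thus ?thesis by (simp add: mult.assoc)
qed

theorem proposition5:
  fixes q t b5 gn fn an :: complex
    and b :: "nat \<Rightarrow> complex"
    and n :: nat
    and G :: "complex \<Rightarrow> complex \<times> complex"
    and p :: "complex \<Rightarrow> nat \<Rightarrow> complex poly"
    and a0 :: "complex \<Rightarrow> complex"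
    and Wp Tp Tm Wm :: "nat \<Rightarrow> complex \<Rightarrow> complex poly"
    and g f :: "nat \<Rightarrow> complex \<Rightarrow> complex"
  assumes q: "0 < norm q" "norm q < 1"
    and b_nz: "b 1 \<noteq> 0" "b 2 \<noteq> 0" "b 3 \<noteq> 0" "b 4 \<noteq> 0" "b 6 \<noteq> 0"
    and b_prod: "b 1 * b 2 * b 3 * b 4 = 1"
    and t: "t \<noteq> 0"
    and n: "n \<ge> 1"
    and stieltjes_x: "\<forall>s\<in>{t, q * t}. \<exists>U :: complex poly. \<forall>x.
          x \<notin> q_support q (G s) \<and> q * x \<notin> q_support q (G s) \<longrightarrow>
          D_minus b s x * stieltjes q b (G s) s (q * x)
            = D_plus b s x * stieltjes q b (G s) s x + (q - 1) * x * poly U x"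
    and stieltjes_t: "\<exists>T :: complex poly. \<forall>x.
          x \<notin> q_support q (G t) \<and> x \<notin> q_support q (G (q * t)) \<longrightarrow>
          E_minus q b t x * stieltjes q b (G (q * t)) (q * t) x
            = E_plus q b t x * stieltjes q b (G t) t x + (q - 1) * t * poly T x"
    and orth: "\<forall>s\<in>{t, q * t}. orthonormal_polys q b (G s) s (p s)"
    and a0: "\<forall>s\<in>{t, q * t}. a0 s \<noteq> 0"
    and spectral: "\<forall>s\<in>{t, q * t}. \<forall>m. is_spectral_matrix q b (G s) s (a0 s) (p s) m
          (vector [vector [Wp m s, - Tp m s], vector [Tm m s, Wm m s]])"
    and g: "\<forall>s\<in>{t, q * t}. \<forall>m\<in>{n - 1, n}. poly (Tp m s div [:0, 1:]) (g m s) = 0"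
    and g_nz: "\<forall>s\<in>{t, q * t}. g n s \<noteq> 0 \<and> g n s \<noteq> b 6 * s \<and> g n s \<noteq> inverse (b 6) * s"
    and f: "\<forall>s\<in>{t, q * t}. poly (Wp n s) (g n s)
          = - (1 / s) * (g n s - b 6 * s) * (b 6 * g n s - s) * (f n (inverse q * s) * g n s - 1)"
    and b5: "b5 = b 1 * b 4 * b 6 * q ^ n"
    and gn: "gn = g n t"
    and fn: "fn = f n t"
    and an: "an = rec_coeff (a0 t) (p t) n"
    and b5_sq: "b5\<^sup>2 \<noteq> inverse q" "b5\<^sup>2 \<noteq> 1" "b5\<^sup>2 \<noteq> q"
    and an_nz: "an \<noteq> 0"
    and denominators: "fn \<noteq> 0" "1 - fn * gn \<noteq> 0" "t * gn - b5 \<noteq> 0"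
  shows
    "(Tp n t = smult (b 6 / b5 * (inverse q - b5\<^sup>2) * an) ([:0, 1:] * [:- gn, 1:])) \<and>
     (Tm n t = smult (b 6 / b5 * (1 - inverse q * b5\<^sup>2) * an) ([:0, 1:] * [:- g (n - 1) t, 1:])) \<and>
     (\<forall>x. x \<noteq> 0 \<and> x \<noteq> gn \<longrightarrow>
         poly (Wp n t) x / (x * (x - gn)) =
           - x * b5 * b 6
           + b 6 / (1 - b5\<^sup>2) * (- b5\<^sup>2 / t + b5 * (1 / b 1 + 1 / b 2 + 1 / b 3 + 1 / b 4))
           - b 6 * (b5 * fn - t) / ((1 - b5\<^sup>2) * t)
               * (gn * (t - fn * b5) / fn + t * b5 * (1 + (b 6)\<^sup>2) / b 6)
           + b 6 * t / (1 - b5\<^sup>2)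
               * (b5\<^sup>2 / gn\<^sup>2 - (1 - b5\<^sup>2) / (x * gn)
                  - (b 1 + b 2 + b 3 + b 4) * (b5\<^sup>2 / gn)
                  + b5\<^sup>2 * (fn / gn) - gn / fn
                  + (gn - x * b5\<^sup>2) * (\<Prod>j=1..4. 1 - gn * b j)
                      / ((1 - fn * gn) * gn\<^sup>2 * (x - gn)))) \<and>
     (\<forall>x. x \<noteq> 0 \<and> x \<noteq> gn \<and> 1 - fn * x \<noteq> 0 \<longrightarrow>
         poly (Wp n t) x / (x * (x - gn)) =
           - (b 6 * t / (1 - b5\<^sup>2))
               * ((1 - b5\<^sup>2 * fn * x) * (\<Prod>j=1..4. fn - b j)
                  / (fn\<^sup>2 * (1 - fn * gn) * (1 - fn * x)))
           + b 6 * t * (\<Prod>j=1..4. 1 - x * b j) / (x * (1 - x * fn) * (x - gn))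
           - b 6 * (b5 * fn - t) / fn * x
           - b 6 * (b5 * fn - t) / (b5 * (1 - b5\<^sup>2) * t)
               * (b5\<^sup>2 * (1 + (b 6)\<^sup>2) * t / b 6
                  + b5 * gn / fn * (t - b5 * fn)
                  + b5 / fn\<^sup>2
                      * (t + b5 * fn - t * fn * (1 / b 1 + 1 / b 2 + 1 / b 3 + 1 / b 4)))) \<and>
     (\<forall>x. x \<noteq> 0 \<and> x \<noteq> gn \<longrightarrow>
         t * poly (Wm n t) x / (x * (x - gn)) =
           (1 - x * fn) * (x - b 6 * t) * (x * b 6 - t) / (x * (x - gn))
           - b 6 / (1 - b5\<^sup>2) * ((\<Prod>j=1..4. t - b j * b5) / (b5 * (t * gn - b5)))
           + b 6 * (b5 * fn - t) / (b5 * (1 - b5\<^sup>2))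
               * ((1 - b5\<^sup>2) * x - t\<^sup>2 / gn - gn * b5\<^sup>2
                  + b5\<^sup>2 * (1 + (b 6)\<^sup>2) * t / b 6
                  - b5 * t\<^sup>2 * (\<Prod>j=1..4. 1 - gn * b j)
                      / (gn * (1 - fn * gn) * (t * gn - b5)))) \<and>
     (\<forall>x. x \<noteq> 0 \<and> x \<noteq> gn \<longrightarrow>
         t * poly (Wm n t) x / (x * (x - gn)) =
           (1 - x * fn) * (x - b 6 * t) * (b 6 * x - t) / (x * (x - gn))
           + b 6 * t\<^sup>2 / (1 - b5\<^sup>2)
               * ((\<Prod>j=1..4. fn - b j) / (fn\<^sup>2 * (1 - fn * gn)))
           + b 6 * (b5 * fn - t) / (b5 * (1 - b5\<^sup>2))
               * ((1 - b5\<^sup>2) * x + b5\<^sup>2 * (1 + (b 6)\<^sup>2) * t / b 6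
                  + b5 * gn / fn * (t - b5 * fn)
                  + b5 / fn\<^sup>2
                      * (t + b5 * fn - t * fn * (1 / b 1 + 1 / b 2 + 1 / b 3 + 1 / b 4))))"
proof -
  obtain m where m: "n = Suc m" using n by (cases n) auto
  have qnz: "q \<noteq> 0" using q by auto
  from stieltjes_x obtain U U' where
    U: "\<And>x. x \<notin> q_support q (G t) \<Longrightarrow> q * x \<notin> q_support q (G t) \<Longrightarrow>
        D_minus b t x * stieltjes q b (G t) t (q * x) = D_plus b t x * stieltjes q b (G t) t x + (q - 1) * x * poly U x"
    and U': "\<And>x. x \<notin> q_support q (G (q * t)) \<Longrightarrow> q * x \<notin> q_support q (G (q * t)) \<Longrightarrow>
        D_minus b (q * t) x * stieltjes q b (G (q * t)) (q * t) (q * x)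
          = D_plus b (q * t) x * stieltjes q b (G (q * t)) (q * t) x + (q - 1) * x * poly U' x"
    by auto
  from stieltjes_t obtain T where
    T: "\<And>x. x \<notin> q_support q (G t) \<Longrightarrow> x \<notin> q_support q (G (q * t)) \<Longrightarrow>
        E_minus q b t x * stieltjes q b (G (q * t)) (q * t) x
          = E_plus q b t x * stieltjes q b (G t) t x + (q - 1) * t * poly T x" by auto
  interpret t_evolution q t b "G t" "p t" "a0 t" U "G (q * t)" "p (q * t)" "a0 (q * t)" U' T
    by unfold_locales (use qnz q b_nz t orth a0 U U' T in auto)
  have spec: "is_spectral_matrix q b (G t) t (a0 t) (p t) k (vector [vector [Wp k t, - Tp k t], vector [Tm k t, Wm k t]])" for k
    using spectral by auto
  have spec': "is_spectral_matrix q b (G (q * t)) (q * t) (a0 (q * t)) (p (q * t)) k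
      (vector [vector [Wp k (q * t), - Tp k (q * t)], vector [Tm k (q * t), Wm k (q * t)]])" for k
    using spectral by auto
  note specn = spec[of "Suc m", folded m] and specn' = spec'[of "Suc m", folded m]

  have b5nz: "b5 \<noteq> 0" using b5 b_nz qnz by simp
  have b23: "b 2 * b 3 / q ^ n = b 6 / b5"
    using b_prod b_nz qnz unfolding b5 by (simp add: field_simps)
  have b14: "b 1 * b 4 * (b 6)\<^sup>2 * q ^ n = b5 * b 6" unfolding b5 by (simp add: power2_eq_square)
  have lead: "b 2 * b 3 / q ^ Suc n - b 1 * b 4 * (b 6)\<^sup>2 * q ^ n = b 6 / b5 * (inverse q - b5\<^sup>2)"
  proof -
    have "b 2 * b 3 / q ^ Suc n = b 6 / b5 / q" unfolding b23[symmetric] by (simp add: mult.commute)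
    thus ?thesis unfolding b14 using b5nz qnz by (simp add: field_simps power2_eq_square)
  qed
  have Tpn: "Tp n t = smult (b 6 / b5 * (inverse q - b5\<^sup>2) * an) ([:0, 1:] * [:- gn, 1:])"
    using root_form[of "Tp n t" gn] A.Tp_shape[OF spec[of n]] g unfolding lead an gn
    by (simp add: mult.commute)
  have lead': "b 2 * b 3 / q ^ Suc m - b 1 * b 4 * (b 6)\<^sup>2 * q ^ m = b 6 / b5 * (1 - inverse q * b5\<^sup>2)"
  proof -
    have 1: "b 1 * b 4 * (b 6)\<^sup>2 * q ^ m = b5 * b 6 / q" unfolding b14[symmetric] m using qnz by simp
    have 2: "b 2 * b 3 / q ^ Suc m = b 6 / b5" using b23 unfolding m .
    show ?thesis unfolding 1 2 using b5nz qnz by (simp add: field_simps power2_eq_square)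
  qed
  have "Tp m t = smult (A.a m * (b 6 / b5 * (1 - inverse q * b5\<^sup>2))) ([:0, 1:] * [:- g m t, 1:])"
    using root_form[of "Tp m t" "g m t"] A.Tp_shape[OF spec[of m]] g unfolding lead' m by simp
  hence Tmn: "Tm n t = smult (b 6 / b5 * (1 - inverse q * b5\<^sup>2) * an) ([:0, 1:] * [:- g (n - 1) t, 1:])"
    using A.Tm_eq_Tp[OF spec[of "Suc m"] spec[of m]] A.a_nonzero[of m] unfolding an m
    by (simp add: mult_ac)

  have Tp_nz: "Tp n t \<noteq> 0"
    unfolding Tpn using b_nz b5nz b5_sq an_nz by auto
  have Tp_root: "poly (Tp n t) gn = 0" unfolding Tpn by simp
  have Tp_root': "poly (Tp n (q * t)) (g n (q * t)) = 0"
  proof -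
    have "Tp n (q * t) = smult (coeff (Tp n (q * t)) 2) ([:0, 1:] * [:- g n (q * t), 1:])"
      using B.Tp_shape[OF spec'[of n]] g by (intro root_form) auto
    hence "poly (Tp n (q * t)) (g n (q * t)) = poly (smult (coeff (Tp n (q * t)) 2) ([:0, 1:] * [:- g n (q * t), 1:])) (g n (q * t))"
      by (rule arg_cong)
    thus ?thesis by simp
  qed
  have Quad_nz: "Quad s y \<noteq> 0" if "y \<noteq> b 6 * s" "y \<noteq> inverse (b 6) * s" for s y
  proof -
    have "s - b 6 * y \<noteq> 0"
    proof
      assume "s - b 6 * y = 0"
      hence "y = inverse (b 6) * s" using b_nz by simp
      thus False using that by simp
    qed
    thus ?thesis using that by simp
  qed
  have g_nz': "g n s \<noteq> 0 \<and> Quad s (g n s) \<noteq> 0" if "s \<in> {t, q * t}" for s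
    using g_nz that Quad_nz[of "g n s" s] by blast
  have gnz: "gn \<noteq> 0" "Quad t gn \<noteq> 0" "g n (q * t) \<noteq> 0" "Quad (q * t) (g n (q * t)) \<noteq> 0"
    using g_nz' unfolding gn by blast+
  have f': "q * t * poly (Wp n (q * t)) (g n (q * t)) = Quad (q * t) (g n (q * t)) * (1 - fn * g n (q * t))"
  proof -
    have eq: "poly (Wp n (q * t)) (g n (q * t)) = - (1 / (q * t)) * (g n (q * t) - b 6 * (q * t))
        * (b 6 * g n (q * t) - q * t) * (f n (inverse q * (q * t)) * g n (q * t) - 1)"
      using f by blast
    have 1: "inverse q * (q * t) = t" using qnz by simp
    have 2: "q * t * (- (1 / (q * t)) * X * Y * Z) = - (X * Y * Z)" for X Y Z
      using qnz t by simp
    show ?thesis unfolding eq fn 1 2 by algebra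
  qed
  have Wm_gn: "t * poly (Wm n t) gn = Quad t gn * (1 - fn * gn)"
    using evolution_at_root[OF spec[of "Suc m"] spec'[of "Suc m"], folded m, OF Tp_nz Tp_root gnz(1,2) Tp_root' gnz(3,4) f'] .

  define e1 e2 e3 where "e1 = b 1 + b 2 + b 3 + b 4"
    and "e2 = b 1 * b 2 + b 1 * b 3 + b 1 * b 4 + b 2 * b 3 + b 2 * b 4 + b 3 * b 4"
    and "e3 = 1 / b 1 + 1 / b 2 + 1 / b 3 + 1 / b 4"
  have e3: "e3 = b 2 * b 3 * b 4 + b 1 * b 3 * b 4 + b 1 * b 2 * b 4 + b 1 * b 2 * b 3"
  proof -
    have "1 / b 1 = b 2 * b 3 * b 4" "1 / b 2 = b 1 * b 3 * b 4" "1 / b 3 = b 1 * b 2 * b 4" "1 / b 4 = b 1 * b 2 * b 3"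
      using b_prod b_nz by (simp_all add: divide_eq_eq mult_ac)
    thus ?thesis unfolding e3_def by simp
  qed
  have prod1: "(\<Prod>j=1..4. 1 - y * b j) = 1 - e1 * y + e2 * y\<^sup>2 - e3 * y ^ 3 + y ^ 4" for y
    unfolding prod_1_4 e1_def e2_def e3 using b_prod by algebra
  have prod2: "(\<Prod>j=1..4. z - b j) = z ^ 4 - e1 * z ^ 3 + e2 * z\<^sup>2 - e3 * z + 1" for z
    unfolding prod_1_4 e1_def e2_def e3 using b_prod by algebra
  have prod3: "(\<Prod>j=1..4. t - b j * b5) = t ^ 4 - e1 * t ^ 3 * b5 + e2 * t\<^sup>2 * b5\<^sup>2 - e3 * t * b5 ^ 3 + b5 ^ 4"
    unfolding prod_1_4 e1_def e2_def e3 using b_prod by algebra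
  have DD: "D_plus b t x * D_minus b t x = b 6 * (\<Prod>j=1..4. 1 - x * b j) * Quad t x" for x
    unfolding prod_1_4 D_plus_def D_minus_def by (simp add: mult_ac)

  define w1 w2 v1 v2 where "w1 = coeff (Wp n t) 1" and "w2 = coeff (Wp n t) 2"
    and "v1 = coeff (Wm n t) 1" and "v2 = coeff (Wm n t) 2"
  note Wsh = A.W_shape[OF spec[of "Suc m"], folded m, unfolded b14 b23]
  have Wp: "poly (Wp n t) x = - b5 * b 6 * x ^ 3 + w2 * x\<^sup>2 + w1 * x + b 6 * t" for x
    using cubic_form[OF Wsh(1), of x] by (simp add: Wsh w1_def w2_def)
  have Wm: "poly (Wm n t) x = - (b 6 / b5) * x ^ 3 + v2 * x\<^sup>2 + v1 * x + b 6 * t" for x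
    using cubic_form[OF Wsh(4), of x] by (simp add: Wsh v1_def v2_def)
  have det: "poly (Wp n t) x * poly (Wm n t) x + poly (Tp n t) x * poly (Tm n t) x
      = b 6 * (\<Prod>j=1..4. 1 - x * b j) * Quad t x" for x
    using fun_cong[OF A.spectral_det[OF spec[of n]], of x] unfolding DD .

  define c c' where "c = b 6 / b5 * (inverse q - b5\<^sup>2) * an" and "c' = b 6 / b5 * (1 - inverse q * b5\<^sup>2) * an"
  have detx: "(- b5 * b 6 * x ^ 3 + w2 * x\<^sup>2 + w1 * x + b 6 * t) * (- (b 6 / b5) * x ^ 3 + v2 * x\<^sup>2 + v1 * x + b 6 * t)
      + c * c' * (x * (x - gn)) * (x * (x - g (n - 1) t))
    = (1 - e1 * x + e2 * x\<^sup>2 - e3 * x ^ 3 + x ^ 4) * (b 6 * (b 6 * t\<^sup>2) + (- b 6 * (t * (1 + (b 6)\<^sup>2))) * x + (b 6)\<^sup>2 * x\<^sup>2)" for x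
  proof -
    have Ts: "poly (Tp n t) x = c * (x * (x - gn))" "poly (Tm n t) x = c' * (x * (x - g (n - 1) t))"
      unfolding Tpn Tmn c_def[symmetric] c'_def[symmetric] by (simp_all add: algebra_simps)
    show ?thesis using det[of x] unfolding Ts prod1 Wp Wm by algebra
  qed
  note lin = det_coefficients[OF detx]
  have nz: "b5 \<noteq> 0" "b 6 \<noteq> 0" "t \<noteq> 0" "fn \<noteq> 0" "gn \<noteq> 0" "1 - b5\<^sup>2 \<noteq> 0"
    using b5nz b_nz t denominators gnz b5_sq by auto
  have lin1: "w1 + v1 = - (1 + (b 6)\<^sup>2) - e1 * b 6 * t"
  proof -
    have "b 6 * t * (w1 + v1) = b 6 * t * (- (1 + (b 6)\<^sup>2) - e1 * b 6 * t)" using lin(1) by algebra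
    thus ?thesis using nz by simp
  qed
  have lin5: "b5 * v2 + w2 / b5 = t * (1 + (b 6)\<^sup>2) + e3 * b 6"
  proof -
    have "b 6 * (b5 * v2 + w2 / b5) = b5 * b 6 * v2 + b 6 / b5 * w2" by (simp add: distrib_left)
    also have "\<dots> = b 6 * (t * (1 + (b 6)\<^sup>2) + e3 * b 6)" using lin(2) by algebra
    finally show ?thesis using nz by simp
  qed
  define r \<eta> where "r = (\<Prod>j=1..4. 1 - gn * b j) / (1 - fn * gn)" and "\<eta> = (\<Prod>j=1..4. fn - b j) / (1 - fn * gn)"
  have r: "r * (1 - fn * gn) = (\<Prod>j=1..4. 1 - gn * b j)" and \<eta>': "\<eta> * (1 - fn * gn) = (\<Prod>j=1..4. fn - b j)"
    using denominators by (simp_all add: r_def \<eta>_def)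
  have Wp_g: "- b5 * b 6 * gn ^ 3 + w2 * gn\<^sup>2 + w1 * gn + b 6 * t = b 6 * t * r"
  proof -
    have "poly (Wp n t) gn * (t * poly (Wm n t) gn) = t * b 6 * (r * (1 - fn * gn)) * Quad t gn"
      using det[of gn] unfolding Tp_root r by algebra
    hence "(Quad t gn * (1 - fn * gn)) * poly (Wp n t) gn = (Quad t gn * (1 - fn * gn)) * (b 6 * t * r)"
      unfolding Wm_gn by algebra
    thus ?thesis using gnz(2) denominators(2) unfolding Wp by simp
  qed
  have Wm_g: "t * (- (b 6 / b5) * gn ^ 3 + v2 * gn\<^sup>2 + v1 * gn + b 6 * t) = (t - b 6 * gn) * (b 6 * t - gn) * (1 - fn * gn)"
    using Wm_gn unfolding Wm .
  have \<eta>: "fn\<^sup>2 * r = gn\<^sup>2 * \<eta> + (fn\<^sup>2 - gn\<^sup>2) * (1 + fn * gn) - e1 * fn\<^sup>2 * gn + e3 * fn * gn\<^sup>2"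
  proof -
    have "(1 - fn * gn) * (fn\<^sup>2 * r)
      = (1 - fn * gn) * (gn\<^sup>2 * \<eta> + (fn\<^sup>2 - gn\<^sup>2) * (1 + fn * gn) - e1 * fn\<^sup>2 * gn + e3 * fn * gn\<^sup>2)"
      using r \<eta>' unfolding prod1 prod2 by algebra
    thus ?thesis using denominators by simp
  qed
  have J: "gn\<^sup>2 * (\<Prod>j=1..4. t - b j * b5) = b5\<^sup>2 * t\<^sup>2 * (\<Prod>j=1..4. 1 - gn * b j) + (t * gn - b5)
      * ((t\<^sup>2 - gn\<^sup>2 * b5\<^sup>2) * (b5 + t * gn) - e1 * t\<^sup>2 * gn * b5 + e3 * t * gn\<^sup>2 * b5\<^sup>2)"
    unfolding prod1 prod3 by algebra
  note ctx = nz lin1 lin5 Wp_g Wm_g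
  have red: "X * (\<Prod>j=1..4. 1 - gn * b j) / ((1 - fn * gn) * Y * Z) = X * r / (Y * Z)"
    "X * (\<Prod>j=1..4. 1 - gn * b j) / (Y * (1 - fn * gn) * Z) = X * r / (Y * Z)"
    "X * (\<Prod>j=1..4. fn - b j) / (Y * (1 - fn * gn) * Z) = X * \<eta> / (Y * Z)"
    "(\<Prod>j=1..4. fn - b j) / (Y * (1 - fn * gn)) = \<eta> / Y" for X Y Z
    unfolding r[symmetric] \<eta>'[symmetric] using denominators by simp_all
  show ?thesis
  proof (intro conjI allI impI Tpn Tmn, goal_cases)
    case (1 x)
    thus ?case
      unfolding Wp red e1_def[symmetric] e3_def[symmetric] by (intro formula_Wp_g[OF ctx]) auto
  next
    case (2 x)
    thus ?case
      unfolding Wp red prod1[of x] e3_def[symmetric]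
      by (intro formula_Wp_f[OF ctx \<eta>] r[unfolded prod1]) auto
  next
    case (3 x)
    thus ?case
      unfolding Wm red by (intro formula_Wm_g[OF ctx _ _ denominators(3) r J]) auto
  next
    case (4 x)
    thus ?case
      unfolding Wm red e3_def[symmetric] by (intro formula_Wm_f[OF ctx \<eta>]) auto
  qed
qed

end
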